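(* Let $s,t\geq 1$ and let $X\subseteq\mathbb P^n$ be the union of $s$ general linear subvarieties $L_1,\ldots,L_s$ of $\mathbb P^n$, each of dimension $t-1$. Assume $st\le n+1$, set $I=I(X)$, and assume $I\neq 0$. Then $$\widehat\alpha(I)=\begin{cases}1&\text{if }1\le st<n+1,\\ \frac{n+1}{n+1-t}&\text{if } st=n+1.\end{cases}$$ Additionally, if $s\ge 2$, then the resurgences are $$\rho(I)=\rho_a(I)=\frac{2(s-1)}{s}.$$ Furthermore, $$\frac{\alpha(I)}{\widehat\alpha(I)}=\rho_a(I)=\rho(I)=\frac{\omega(I)}{\widehat\alpha(I)}\quad\text{if } n+1=st,$$ $$\frac{\alpha(I)}{\widehat\alpha(I)}<\rho_a(I)=\rho(I)<\frac{\omega(I)}{\widehat\alpha(I)}\quad\text{if } st\le n\text{ and } s\ge 3.$$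
   Context: $k$ is an algebraically closed field of any characteristic, $R=k[\mathbb P^n]=k[x_0,\ldots,x_n]$, and $I(X)\subseteq R$ is the homogeneous ideal of $X$. "General" means that the statement holds for all tuples $(L_1,\ldots,L_s)$ in some nonempty Zariski-open subset of the product of Grassmannians of $(t-1)$-dimensional linear subspaces of $\mathbb P^n$. For a nonzero homogeneous ideal $J\subseteq R$: $\alpha(J)$ is the smallest degree of a nonzero element of $J$; $\omega(J)$ is the largest degree of a minimal generator of $J$; the $m$-th symbolic power is $J^{(m)}=\bigcap_{P\in \mathrm{Ass}(J)}(J^mR_P\cap R)$; the Waldschmidt constant is $\widehat\alpha(J)=\lim_{m\to\infty}\alpha(J^{(m)})/m$ (the limit exists). The resurgence and asymptotic resurgence of $J$ are, with $m,r$ ranging over positive integers, $$\rho(J)=\sup\left\{\tfrac mr\mid J^{(m)}\not\subseteq J^r\right\},\qquad \rho_a(J)=\sup\left\{\tfrac mr\mid J^{(mt')}\not\subseteq J^{rt'}\text{ for all } t'\gg0\right\}.$$ *)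

theory Defs
  imports "HOL-Analysis.Analysis" "HOL-Library.Poly_Mapping"
begin

section \<open>Polynomial rings\<close>

text \<open>
  The polynomial ring over \<open>'k\<close> in variables indexed by \<open>'x\<close>: an exponent vector is a finitely
  supported function \<open>'x \<Rightarrow>\<^sub>0 nat\<close>, and the ring structure is the convolution product of
  \<open>Poly_Mapping\<close>. For a finite index type \<open>'n\<close> with \<open>CARD('n) = n + 1\<close> this is
  \<open>k[x\<^sub>0, \<dots>, x\<^sub>n]\<close>.
\<close>

type_synonym ('x, 'k) mpoly = "('x \<Rightarrow>\<^sub>0 nat) \<Rightarrow>\<^sub>0 'k"

definition mpoly_eval :: "('x, 'k::comm_ring_1) mpoly \<Rightarrow> ('x \<Rightarrow> 'k) \<Rightarrow> 'k" where
  "mpoly_eval f a =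
     (\<Sum>m\<in>Poly_Mapping.keys f. Poly_Mapping.lookup f m *
        (\<Prod>x\<in>Poly_Mapping.keys m. a x ^ Poly_Mapping.lookup m x))"

definition mpoly_vars :: "('x, 'k::comm_ring_1) mpoly \<Rightarrow> 'x set" where
  "mpoly_vars f = (\<Union>m\<in>Poly_Mapping.keys f. Poly_Mapping.keys m)"

definition monom_degree :: "('x \<Rightarrow>\<^sub>0 nat) \<Rightarrow> nat" where
  "monom_degree m = (\<Sum>x\<in>Poly_Mapping.keys m. Poly_Mapping.lookup m x)"

text \<open>Total degree; only meaningful for nonzero polynomials.\<close>

definition mpoly_degree :: "('x, 'k::comm_ring_1) mpoly \<Rightarrow> nat" where
  "mpoly_degree f = Max (monom_degree ` Poly_Mapping.keys f)"

definition homogeneous_poly :: "('x, 'k::comm_ring_1) mpoly \<Rightarrow> bool" where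
  "homogeneous_poly f \<longleftrightarrow> (\<exists>d. \<forall>m\<in>Poly_Mapping.keys f. monom_degree m = d)"


section \<open>Ideals of a commutative ring\<close>

text \<open>Ideals are the submodules of the ring regarded as a module over itself.\<close>

definition ring_ideal :: "'a::comm_ring_1 set \<Rightarrow> bool" where
  "ring_ideal J \<longleftrightarrow> module.subspace (*) J"

definition ideal_gen :: "'a::comm_ring_1 set \<Rightarrow> 'a set" where
  "ideal_gen S = module.span (*) S"

definition ideal_mult :: "'a::comm_ring_1 set \<Rightarrow> 'a set \<Rightarrow> 'a set" where
  "ideal_mult J K = ideal_gen {a * b | a b. a \<in> J \<and> b \<in> K}"

fun ideal_pow :: "'a::comm_ring_1 set \<Rightarrow> nat \<Rightarrow> 'a set" where
  "ideal_pow J 0 = UNIV"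
| "ideal_pow J (Suc m) = ideal_mult J (ideal_pow J m)"

definition ring_prime_ideal :: "'a::comm_ring_1 set \<Rightarrow> bool" where
  "ring_prime_ideal P \<longleftrightarrow>
     ring_ideal P \<and> P \<noteq> UNIV \<and> (\<forall>a b. a * b \<in> P \<longrightarrow> a \<in> P \<or> b \<in> P)"

text \<open>
  \<open>Ass(J)\<close> means the associated primes of the module \<open>R/J\<close>, i.e. the primes that are
  annihilators of the class of some \<open>f\<close> in \<open>R/J\<close>.
\<close>

definition Ass :: "'a::comm_ring_1 set \<Rightarrow> 'a set set" where
  "Ass J = {P. ring_prime_ideal P \<and> (\<exists>f. P = {g. g * f \<in> J})}"

text \<open>Equality of the fractions \<open>a/u\<close> and \<open>b/v\<close> in the localization \<open>R\<^sub>P\<close>, where \<open>u, v \<notin> P\<close>.\<close>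

definition loc_eq :: "'a::comm_ring_1 set \<Rightarrow> 'a \<times> 'a \<Rightarrow> 'a \<times> 'a \<Rightarrow> bool" where
  "loc_eq P = (\<lambda>(a, u) (b, v). \<exists>w. w \<notin> P \<and> w * (v * a - u * b) = 0)"

text \<open>
  \<open>J R\<^sub>P \<inter> R\<close>, the preimage of \<open>J R\<^sub>P\<close> under \<open>f \<mapsto> f/1\<close>. The elements of \<open>J R\<^sub>P\<close> are the
  fractions \<open>g/u\<close> with \<open>g \<in> J\<close> and \<open>u \<notin> P\<close>.
\<close>

definition loc_contraction :: "'a::comm_ring_1 set \<Rightarrow> 'a set \<Rightarrow> 'a set" where
  "loc_contraction J P = {f. \<exists>g\<in>J. \<exists>u. u \<notin> P \<and> loc_eq P (f, 1) (g, u)}"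

definition symbolic_power :: "'a::comm_ring_1 set \<Rightarrow> nat \<Rightarrow> 'a set" where
  "symbolic_power J m = (\<Inter>P\<in>Ass J. loc_contraction (ideal_pow J m) P)"


section \<open>Invariants of homogeneous ideals\<close>

definition alpha :: "('x, 'k::comm_ring_1) mpoly set \<Rightarrow> nat" where
  "alpha J = (LEAST d. \<exists>f\<in>J. f \<noteq> 0 \<and> mpoly_degree f = d)"

definition min_hom_gens :: "('x, 'k::comm_ring_1) mpoly set \<Rightarrow> ('x, 'k) mpoly set \<Rightarrow> bool" where
  "min_hom_gens J G \<longleftrightarrow>
     (\<forall>g\<in>G. homogeneous_poly g) \<and> ideal_gen G = J \<and> (\<forall>H. H \<subset> G \<longrightarrow> ideal_gen H \<noteq> J)"

text \<open>
  By the graded Nakayama lemma the degrees occurring in a minimal homogeneous generating set do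
  not depend on the set, and there are finitely many of them.
\<close>

definition omega :: "('x, 'k::comm_ring_1) mpoly set \<Rightarrow> nat" where
  "omega J = (GREATEST d. \<exists>G. min_hom_gens J G \<and> (\<exists>g\<in>G. mpoly_degree g = d))"

definition waldschmidt :: "('x, 'k::comm_ring_1) mpoly set \<Rightarrow> real" where
  "waldschmidt J = lim (\<lambda>m. real (alpha (symbolic_power J m)) / real m)"

text \<open>The suprema are taken in the extended reals, so an unbounded set has supremum \<open>\<infinity>\<close>.\<close>

definition resurgence :: "('x, 'k::comm_ring_1) mpoly set \<Rightarrow> ereal" where
  "resurgence J =
     Sup {ereal (real m / real r) | m r. 0 < m \<and> 0 < r \<and> \<not> symbolic_power J m \<subseteq> ideal_pow J r}"

definition asymptotic_resurgence :: "('x, 'k::comm_ring_1) mpoly set \<Rightarrow> ereal" where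
  "asymptotic_resurgence J =
     Sup {ereal (real m / real r) | m r. 0 < m \<and> 0 < r \<and>
            (\<forall>\<^sub>F t' in sequentially. \<not> symbolic_power J (m * t') \<subseteq> ideal_pow J (r * t'))}"


section \<open>Projective space and linear subvarieties\<close>

text \<open>
  With \<open>CARD('n) = n + 1\<close>, the points of \<open>P\<^sup>n\<close> are the one-dimensional subspaces of
  \<open>'k ^ 'n\<close>, and the linear subvarieties of dimension \<open>t - 1\<close> correspond to the
  \<open>t\<close>-dimensional subspaces.
\<close>

definition proj_space :: "('k::field ^ 'n) set set" where
  "proj_space = {l. vec.subspace l \<and> vec.dim l = 1}"

definition linear_subvariety :: "('k::field ^ 'n) set \<Rightarrow> ('k ^ 'n) set set" where
  "linear_subvariety V = {l \<in> proj_space. l \<subseteq> V}"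

text \<open>A homogeneous polynomial vanishes at a point iff it vanishes on the corresponding line.\<close>

definition vanishing_ideal :: "('k::field ^ 'n) set set \<Rightarrow> ('n, 'k) mpoly set" where
  "vanishing_ideal X =
     ideal_gen {f. homogeneous_poly f \<and> (\<forall>l\<in>X. \<forall>v\<in>l. mpoly_eval f (\<lambda>i. v $ i) = 0)}"

definition grassmannian :: "nat \<Rightarrow> ('k::field ^ 'n) set set" where
  "grassmannian t = {V. vec.subspace V \<and> vec.dim V = t}"

text \<open>
  The Zariski topology on the \<open>s\<close>-fold product of Grassmannians. The Grassmannian is the quotient
  by \<open>GL\<^sub>t\<close> of the variety of frames (linearly independent \<open>t\<close>-tuples of vectors) under
  the map sending a frame to its span; likewise the \<open>s\<close>-fold product is the quotient of the variety
  of \<open>s\<close>-tuples of frames by \<open>GL\<^sub>t\<^sup>s\<close>. Its topology is the quotient topology: \<open>U\<close> is open iff its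
  preimage is the locus, within the \<open>s\<close>-tuples of frames, where some member of a set \<open>F\<close> of
  polynomials in the \<open>s t (n + 1)\<close> coordinates does not vanish. (For \<open>t = s = 1\<close> this is the usual
  topology of \<open>P\<^sup>n\<close> as a quotient of the punctured affine space.) Note that this is the topology of
  the product variety, which is finer than the product topology.
\<close>

definition frame :: "nat \<Rightarrow> (nat \<Rightarrow> 'k::field ^ 'n) \<Rightarrow> bool" where
  "frame t w \<longleftrightarrow> inj_on w {..<t} \<and> vec.independent (w ` {..<t})"

definition zariski_open_grassmannians ::
    "nat \<Rightarrow> nat \<Rightarrow> (nat \<Rightarrow> ('k::field ^ 'n) set) set \<Rightarrow> bool" where
  "zariski_open_grassmannians s t U \<longleftrightarrow>
     U \<subseteq> (\<Pi>\<^sub>E i\<in>{..<s}. grassmannian t) \<and>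
     (\<exists>F :: (nat \<times> nat \<times> 'n, 'k) mpoly set.
        (\<forall>f\<in>F. mpoly_vars f \<subseteq> {..<s} \<times> {..<t} \<times> UNIV) \<and>
        (\<forall>w. (\<forall>i<s. frame t (w i)) \<longrightarrow>
           ((\<lambda>i\<in>{..<s}. vec.span (w i ` {..<t})) \<in> U \<longleftrightarrow>
            (\<exists>f\<in>F. mpoly_eval f (\<lambda>(i, j, c). w i j $ c) \<noteq> 0))))"

text \<open>\<open>Q\<close> holds for \<open>s\<close> general linear subvarieties of dimension \<open>t - 1\<close>.\<close>

definition for_general_subspaces ::
    "nat \<Rightarrow> nat \<Rightarrow> ((nat \<Rightarrow> ('k::field ^ 'n) set) \<Rightarrow> bool) \<Rightarrow> bool" where
  "for_general_subspaces s t Q \<longleftrightarrow>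
     (\<exists>U. zariski_open_grassmannians s t U \<and> U \<noteq> {} \<and> (\<forall>V\<in>U. Q V))"

end

theory Submission
  imports Defs "HOL-Computational_Algebra.Polynomial"
begin

text \<open>
  Since \<open>s t \<le> n + 1\<close>, general subspaces are jointly independent, so a linear change of coordinates
  makes them the coordinate subspaces on disjoint blocks of \<open>t\<close> variables, and \<open>I\<close> becomes a monomial
  ideal. A monomial with block degrees \<open>a\<^sub>0, \<dots>, a\<^sub>s\<^sub>-\<^sub>1\<close> and degree \<open>c\<close> in the remaining variables
  lies in the \<open>m\<close>-th symbolic power iff its degree outside each block is at least \<open>m\<close>; it lies in the
  \<open>r\<close>-th ordinary power iff its degree outside each block is at least \<open>r\<close> and moreover
  \<open>a\<^sub>0 + \<dots> + a\<^sub>s\<^sub>-\<^sub>1 + 2 c \<ge> 2 r\<close>. Summing the conditions of the symbolic power over the blocks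
  bounds degrees from below and resurgences from above, and the monomials with all \<open>a\<^sub>i\<close> equal and
  \<open>c = 0\<close> show that these bounds are sharp.
\<close>

section \<open>Ideals and ring automorphisms\<close>

text \<open>The constant \<open>2 (s - 1) / s\<close> comes from comparing two weights. A variable
  of a block counts in the outside degrees of \<open>s - 1\<close> blocks, a variable off all blocks
  in those of all \<open>s\<close>; the extra inequality for ordinary powers gives them weights 1
  and 2 instead. For \<open>s \<ge> 2\<close> the summed outside weights are at most
  \<open>s - 1\<close> times the latter weights, with equality on the block variables.

  The obstacle is that associated primes, localisations and minimal generating sets quantify over
  arbitrary polynomials, so testing monomials is not enough. Each linear inequality is therefore
  recast as the ideal of all polynomials whose monomials have weighted degree at least
  \<open>d\<close>. Over a domain the least weight occurring in a polynomial is additive on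
  products; this yields the primality of these ideals for \<open>d = 1\<close>, the colon ideals
  that determine the associated primes, and the cancellation of denominators.

  The change of coordinates uses that an algebraically closed field is infinite: polynomials are
  determined by their values, where a linear substitution is composition with a matrix.\<close>

lemma module_mult: "module ((*) :: 'a::comm_ring_1 \<Rightarrow> 'a \<Rightarrow> 'a)"
  by unfold_locales (simp_all add: algebra_simps)

lemma ring_ideal_iff:
  "ring_ideal (J :: 'a::comm_ring_1 set) \<longleftrightarrow>
    0 \<in> J \<and> (\<forall>x\<in>J. \<forall>y\<in>J. x + y \<in> J) \<and> (\<forall>c. \<forall>x\<in>J. c * x \<in> J)"
  unfolding ring_ideal_def by (rule module.subspace_def[OF module_mult])

lemma
  assumes "ring_ideal (J :: 'a::comm_ring_1 set)"
  shows ring_ideal_0: "0 \<in> J"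
    and ring_ideal_add: "x \<in> J \<Longrightarrow> y \<in> J \<Longrightarrow> x + y \<in> J"
    and ring_ideal_mult: "x \<in> J \<Longrightarrow> c * x \<in> J"
  using assms unfolding ring_ideal_iff by auto

lemma ring_ideal_sum:
  assumes "ring_ideal (J :: 'a::comm_ring_1 set)" "\<And>x. x \<in> B \<Longrightarrow> g x \<in> J"
  shows "sum g B \<in> J"
  using assms(2)
  by (induction B rule: infinite_finite_induct) (auto intro: ring_ideal_0 ring_ideal_add assms(1))

lemma ring_ideal_UNIV: "ring_ideal UNIV"
  by (simp add: ring_ideal_iff)

lemma ring_ideal_ideal_gen: "ring_ideal (ideal_gen S)"
  unfolding ring_ideal_def ideal_gen_def by (rule module.subspace_span[OF module_mult])

lemma ideal_gen_base: "x \<in> S \<Longrightarrow> x \<in> ideal_gen S"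
  unfolding ideal_gen_def by (rule module.span_base[OF module_mult])

lemma ideal_gen_least: "S \<subseteq> J \<Longrightarrow> ring_ideal J \<Longrightarrow> ideal_gen S \<subseteq> J"
  unfolding ring_ideal_def ideal_gen_def by (rule module.span_minimal[OF module_mult])

lemma ideal_gen_mono: "S \<subseteq> T \<Longrightarrow> ideal_gen S \<subseteq> ideal_gen T"
  unfolding ideal_gen_def by (rule module.span_mono[OF module_mult])

lemma ideal_gen_induct [consumes 1, case_names zero add]:
  assumes "x \<in> ideal_gen S" "P 0" "\<And>c g y. g \<in> S \<Longrightarrow> P y \<Longrightarrow> P (c * g + y)"
  shows "P x"
  using assms unfolding ideal_gen_def by (rule module.span_induct_alt[OF module_mult])

lemma ring_ideal_ideal_mult: "ring_ideal (ideal_mult J K)"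
  unfolding ideal_mult_def by (rule ring_ideal_ideal_gen)

lemma ideal_multI: "a \<in> J \<Longrightarrow> b \<in> K \<Longrightarrow> a * b \<in> ideal_mult J K"
  unfolding ideal_mult_def by (rule ideal_gen_base) blast

lemma ideal_mult_least:
  "(\<And>a b. a \<in> J \<Longrightarrow> b \<in> K \<Longrightarrow> a * b \<in> L) \<Longrightarrow> ring_ideal L \<Longrightarrow> ideal_mult J K \<subseteq> L"
  unfolding ideal_mult_def by (rule ideal_gen_least) auto

lemma ring_ideal_ideal_pow: "ring_ideal (ideal_pow J m)"
  by (cases m) (simp_all add: ring_ideal_UNIV ring_ideal_ideal_mult)

lemma ring_prime_idealD:
  assumes "ring_prime_ideal P"
  shows "ring_ideal P" "P \<noteq> UNIV" "a * b \<in> P \<Longrightarrow> a \<in> P \<or> b \<in> P"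
  using assms unfolding ring_prime_ideal_def by auto

lemma ring_prime_ideal_1: "ring_prime_ideal P \<Longrightarrow> 1 \<notin> P"
  using ring_ideal_mult[of P 1] by (force dest: ring_prime_idealD)

text \<open>Clearing denominators: the element \<open>w\<close> that witnesses equality of two
  fractions is merged into \<open>u\<close>, because the complement of a prime is multiplicatively
  closed.\<close>

lemma loc_contraction_prime:
  assumes J: "ring_ideal J" and P: "ring_prime_ideal P"
  shows "loc_contraction J P = {f. \<exists>u. u \<notin> P \<and> u * f \<in> J}"
proof (intro equalityI subsetI)
  fix f assume "f \<in> loc_contraction J P"
  then obtain g u w where g: "g \<in> J" and uw: "u \<notin> P" "w \<notin> P" and eq: "w * (u * f - 1 * g) = 0"
    unfolding loc_contraction_def loc_eq_def by auto
  have "(w * u) * f = w * g"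
    using eq by (simp add: algebra_simps)
  then have "(w * u) * f \<in> J"
    using g J by (simp add: ring_ideal_mult)
  then show "f \<in> {f. \<exists>u. u \<notin> P \<and> u * f \<in> J}"
    using uw ring_prime_idealD(3)[OF P] by blast
next
  fix f assume "f \<in> {f. \<exists>u. u \<notin> P \<and> u * f \<in> J}"
  then obtain u where u: "u \<notin> P" "u * f \<in> J" by auto
  have "loc_eq P (f, 1) (u * f, u)"
    unfolding loc_eq_def using ring_prime_ideal_1[OF P] by auto
  then show "f \<in> loc_contraction J P"
    unfolding loc_contraction_def using u by blast
qed

section \<open>Transport of ideal-theoretic constructions along an automorphism\<close>

locale ring_automorphism =
  fixes \<phi> :: "'a::comm_ring_1 \<Rightarrow> 'a"
  assumes bij: "bij \<phi>"
    and add: "\<phi> (a + b) = \<phi> a + \<phi> b"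
    and mult: "\<phi> (a * b) = \<phi> a * \<phi> b"
begin

lemma zero: "\<phi> 0 = 0"
  using add[of 0 0] by simp

lemma image_iff: "\<phi> x \<in> \<phi> ` S \<longleftrightarrow> x \<in> S"
  using bij by (simp add: bij_is_inj inj_image_mem_iff)

lemma ring_automorphism_inv: "ring_automorphism (inv \<phi>)"
proof
  show "bij (inv \<phi>)" using bij by (rule bij_imp_bij_inv)
  have *: "\<phi> (inv \<phi> a) = a" "inv \<phi> (\<phi> a) = a" for a
    using bij by (simp_all add: bij_is_surj surj_f_inv_f bij_is_inj)
  show "inv \<phi> (a + b) = inv \<phi> a + inv \<phi> b" for a b
    by (metis * add)
  show "inv \<phi> (a * b) = inv \<phi> a * inv \<phi> b" for a b
    by (metis * mult)
qed

lemma ring_ideal_image: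
  assumes "ring_ideal J" shows "ring_ideal (\<phi> ` J)"
  unfolding ring_ideal_iff
proof (intro conjI ballI allI)
  show "0 \<in> \<phi> ` J" using zero ring_ideal_0[OF assms] by force
  show "x + y \<in> \<phi> ` J" if "x \<in> \<phi> ` J" "y \<in> \<phi> ` J" for x y
    using that ring_ideal_add[OF assms] add[symmetric] by auto
  show "c * x \<in> \<phi> ` J" if "x \<in> \<phi> ` J" for c x
  proof -
    obtain d where "c = \<phi> d" using bij by (metis bij_pointE)
    then show ?thesis using that ring_ideal_mult[OF assms] mult[symmetric] by auto
  qed
qed

lemma ring_ideal_vimage: "ring_ideal J \<Longrightarrow> ring_ideal (\<phi> -` J)"
  unfolding ring_ideal_iff by (auto simp: zero add mult)

lemma ideal_gen_image: "ideal_gen (\<phi> ` S) = \<phi> ` ideal_gen S"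
proof
  show "ideal_gen (\<phi> ` S) \<subseteq> \<phi> ` ideal_gen S"
    by (intro ideal_gen_least ring_ideal_image ring_ideal_ideal_gen) (auto intro: ideal_gen_base)
  have "ideal_gen S \<subseteq> \<phi> -` ideal_gen (\<phi> ` S)"
    by (intro ideal_gen_least ring_ideal_vimage ring_ideal_ideal_gen) (auto intro: ideal_gen_base)
  then show "\<phi> ` ideal_gen S \<subseteq> ideal_gen (\<phi> ` S)" by auto
qed

lemma ideal_mult_image: "ideal_mult (\<phi> ` J) (\<phi> ` K) = \<phi> ` ideal_mult J K"
proof -
  have "{a * b | a b. a \<in> \<phi> ` J \<and> b \<in> \<phi> ` K} = \<phi> ` {a * b | a b. a \<in> J \<and> b \<in> K}"
    by (force simp flip: mult)
  then show ?thesis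
    unfolding ideal_mult_def by (simp add: ideal_gen_image)
qed

lemma ideal_pow_image: "ideal_pow (\<phi> ` J) m = \<phi> ` ideal_pow J m"
  by (induction m) (use bij in \<open>simp_all add: ideal_mult_image bij_is_surj\<close>)

lemma ring_prime_ideal_image:
  assumes "ring_prime_ideal P" shows "ring_prime_ideal (\<phi> ` P)"
  unfolding ring_prime_ideal_def
proof (intro conjI allI impI)
  show "ring_ideal (\<phi> ` P)" using assms by (simp add: ring_prime_idealD ring_ideal_image)
  show "\<phi> ` P \<noteq> UNIV"
    using ring_prime_idealD(2)[OF assms] bij by (metis UNIV_I image_iff UNIV_eq_I)
  show "a \<in> \<phi> ` P \<or> b \<in> \<phi> ` P" if "a * b \<in> \<phi> ` P" for a b
  proof -
    obtain c d where [simp]: "a = \<phi> c" "b = \<phi> d" using bij by (metis bij_pointE)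
    show ?thesis
      using that ring_prime_idealD(3)[OF assms] by (simp add: mult[symmetric] image_iff)
  qed
qed

lemma Ass_image_superset: "(`) \<phi> ` Ass J \<subseteq> Ass (\<phi> ` J)"
proof
  fix Q assume "Q \<in> (`) \<phi> ` Ass J"
  then obtain P f where Q: "Q = \<phi> ` P" and P: "ring_prime_ideal P" "P = {g. g * f \<in> J}"
    unfolding Ass_def by auto
  have "x \<in> Q \<longleftrightarrow> x * \<phi> f \<in> \<phi> ` J" for x
  proof -
    obtain y where "x = \<phi> y" using bij by (metis bij_pointE)
    then show ?thesis unfolding Q P(2) by (simp add: mult[symmetric] image_iff)
  qed
  then show "Q \<in> Ass (\<phi> ` J)"
    unfolding Ass_def using ring_prime_ideal_image[OF P(1)] Q
    by (intro CollectI conjI exI[of _ "\<phi> f"]) auto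
qed

text \<open>The inclusion just proved, applied to the inverse automorphism and the image ideal,
  gives the opposite inclusion.\<close>

lemma Ass_image: "Ass (\<phi> ` J) = (`) \<phi> ` Ass J"
proof
  interpret inv: ring_automorphism "inv \<phi>" by (rule ring_automorphism_inv)
  have inv: "inv \<phi> ` \<phi> ` S = S" "\<phi> ` inv \<phi> ` S = S" for S
    using bij by (simp_all add: bij_is_inj image_f_inv_f bij_is_surj)
  show "Ass (\<phi> ` J) \<subseteq> (`) \<phi> ` Ass J"
  proof
    fix P assume "P \<in> Ass (\<phi> ` J)"
    then have "inv \<phi> ` P \<in> Ass J"
      using inv.Ass_image_superset[of "\<phi> ` J"] inv by auto
    then show "P \<in> (`) \<phi> ` Ass J" using inv(2) by (metis imageI)
  qed
qed (rule Ass_image_superset)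

lemma loc_contraction_image:
  assumes "ring_ideal J" "ring_prime_ideal P"
  shows "loc_contraction (\<phi> ` J) (\<phi> ` P) = \<phi> ` loc_contraction J P"
proof -
  have "x \<in> loc_contraction (\<phi> ` J) (\<phi> ` P) \<longleftrightarrow> x \<in> \<phi> ` loc_contraction J P" for x
  proof -
    obtain y where y: "x = \<phi> y" using bij by (metis bij_pointE)
    have "(\<exists>u. u \<notin> \<phi> ` P \<and> u * \<phi> y \<in> \<phi> ` J) \<longleftrightarrow> (\<exists>u. \<phi> u \<notin> \<phi> ` P \<and> \<phi> u * \<phi> y \<in> \<phi> ` J)"
      using bij by (metis bij_pointE)
    then show ?thesis
      using assms by (simp add: y image_iff loc_contraction_prime ring_ideal_image
          ring_prime_ideal_image mult[symmetric])
  qed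
  then show ?thesis by blast
qed

lemma symbolic_power_image: "symbolic_power (\<phi> ` J) m = \<phi> ` symbolic_power J m"
proof -
  have "loc_contraction (\<phi> ` ideal_pow J m) (\<phi> ` P) = \<phi> ` loc_contraction (ideal_pow J m) P"
    if "P \<in> Ass J" for P
    using that by (intro loc_contraction_image ring_ideal_ideal_pow) (simp add: Ass_def)
  then have "symbolic_power (\<phi> ` J) m = (\<Inter>P\<in>Ass J. \<phi> ` loc_contraction (ideal_pow J m) P)"
    unfolding symbolic_power_def Ass_image by (simp add: ideal_pow_image)
  \<comment> \<open>Bijectivity also covers an empty set of associated primes, where both sides are
    the whole ring.\<close>
  also have "\<dots> = \<phi> ` symbolic_power J m"
    unfolding symbolic_power_def by (rule bij_image_INT[OF bij, symmetric])
  finally show ?thesis .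
qed

end

lemma resurgence_automorphism_image:
  assumes "ring_automorphism \<phi>"
  shows "resurgence (\<phi> ` J) = resurgence J"
  unfolding resurgence_def ring_automorphism.symbolic_power_image[OF assms]
    ring_automorphism.ideal_pow_image[OF assms]
  by (simp add: inj_image_subset_iff[OF bij_is_inj[OF ring_automorphism.bij[OF assms]]])

lemma asymptotic_resurgence_automorphism_image:
  assumes "ring_automorphism \<phi>"
  shows "asymptotic_resurgence (\<phi> ` J) = asymptotic_resurgence J"
  unfolding asymptotic_resurgence_def ring_automorphism.symbolic_power_image[OF assms]
    ring_automorphism.ideal_pow_image[OF assms]
  by (simp add: inj_image_subset_iff[OF bij_is_inj[OF ring_automorphism.bij[OF assms]]])

section \<open>Evaluation and weights of monomials\<close>

abbreviation "lookup \<equiv> Poly_Mapping.lookup"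
abbreviation "keys \<equiv> Poly_Mapping.keys"
abbreviation "single \<equiv> Poly_Mapping.single"

lemma poly_mapping_sum_monomials: "(\<Sum>m\<in>keys f. single m (lookup f m)) = f"
  by (rule poly_mapping_eqI)
     (auto simp: lookup_sum lookup_single when_def in_keys_iff)

lemma mult_sum_monomials:
  "f * g = (\<Sum>m\<in>keys f. \<Sum>n\<in>keys g. single (m + n) (lookup f m * lookup g n))"
  by (subst (1) poly_mapping_sum_monomials[symmetric, of f],
      subst (1) poly_mapping_sum_monomials[symmetric, of g])
     (simp add: sum_product mult_single)

lemma mpoly_eval_0 [simp]: "mpoly_eval 0 a = 0"
  by (simp add: mpoly_eval_def)

lemma mpoly_eval_add: "mpoly_eval (f + g) a = mpoly_eval f a + mpoly_eval g a"
  unfolding mpoly_eval_def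
  by (rule setsum_keys_plus_distrib) (simp_all add: algebra_simps)

lemma mpoly_eval_single:
  "mpoly_eval (single m c) a = c * (\<Prod>x\<in>keys m. a x ^ lookup m x)"
  by (simp add: mpoly_eval_def)

lemma mpoly_eval_1 [simp]: "mpoly_eval 1 a = 1"
  by (simp add: mpoly_eval_single flip: single_one)

lemma mpoly_eval_uminus: "mpoly_eval (- f) a = - mpoly_eval f a"
  using mpoly_eval_add[of f "- f" a] by (simp add: eq_neg_iff_add_eq_0 add.commute)

lemma mpoly_eval_diff: "mpoly_eval (f - g) a = mpoly_eval f a - mpoly_eval g a"
  using mpoly_eval_add[of f "- g" a] by (simp add: mpoly_eval_uminus)

lemma mpoly_eval_sum: "mpoly_eval (sum g A) a = (\<Sum>x\<in>A. mpoly_eval (g x) a)"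
  by (induction A rule: infinite_finite_induct) (simp_all add: mpoly_eval_add)

lemma prod_power_keys_superset:
  assumes "finite S" "keys m \<subseteq> S"
  shows "(\<Prod>x\<in>keys m. a x ^ lookup m x) = (\<Prod>x\<in>S. a x ^ lookup m x)"
  using assms by (intro prod.mono_neutral_left) (auto simp: in_keys_iff)

lemma prod_power_keys_add:
  "(\<Prod>x\<in>keys (m + n). a x ^ lookup (m + n) x) =
    (\<Prod>x\<in>keys m. a x ^ lookup m x) * (\<Prod>x\<in>keys n. (a x :: 'k::comm_ring_1) ^ lookup n x)"
proof -
  have *: "(\<Prod>x\<in>keys k. a x ^ lookup k x) = (\<Prod>x\<in>keys m \<union> keys n. a x ^ lookup k x)"
    if "keys k \<subseteq> keys m \<union> keys n" for k
    using that by (intro prod_power_keys_superset) auto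
  show ?thesis
    unfolding *[OF Poly_Mapping.keys_add] *[OF Un_upper1] *[OF Un_upper2]
    by (simp add: lookup_add power_add prod.distrib)
qed

lemma mpoly_eval_mult: "mpoly_eval (f * g) a = mpoly_eval f a * mpoly_eval g a"
  by (simp add: mult_sum_monomials[of f g] mpoly_eval_sum mpoly_eval_single prod_power_keys_add)
     (simp add: mpoly_eval_def sum_product mult_ac)

lemma mpoly_eval_prod: "mpoly_eval (prod g A) a = (\<Prod>x\<in>A. mpoly_eval (g x) a)"
  by (induction A rule: infinite_finite_induct) (simp_all add: mpoly_eval_mult)

lemma mpoly_eval_power: "mpoly_eval (f ^ n) a = mpoly_eval f a ^ n"
  by (induction n) (simp_all add: mpoly_eval_mult)

lemma mpoly_eval_of_int: "mpoly_eval (of_int n) a = of_int n"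
  by (simp add: mpoly_eval_single flip: single_of_int)

text \<open>A coefficient of a product is a convolution sum, and it has a single term when the
  exponent decomposes in only one way. Over a domain such a coefficient cannot cancel.\<close>

lemma lookup_mult_unique:
  assumes "\<mu> \<in> keys f" "\<nu> \<in> keys g"
    and "\<And>\<mu>' \<nu>'. \<mu>' \<in> keys f \<Longrightarrow> \<nu>' \<in> keys g \<Longrightarrow> \<mu>' + \<nu>' = \<mu> + \<nu> \<Longrightarrow> \<mu>' = \<mu> \<and> \<nu>' = \<nu>"
  shows "lookup (f * g) (\<mu> + \<nu>) = lookup f \<mu> * lookup g \<nu>"
proof -
  have "lookup (f * g) (\<mu> + \<nu>) =
    (\<Sum>m\<in>keys f. \<Sum>n\<in>keys g. (lookup f m * lookup g n when m + n = \<mu> + \<nu>))"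
    by (simp add: mult_sum_monomials[of f g] lookup_sum lookup_single)
  also have "\<dots> = (\<Sum>m\<in>keys f. \<Sum>n\<in>keys g. if n = \<nu> then if m = \<mu> then lookup f \<mu> * lookup g \<nu> else 0 else 0)"
    by (intro sum.cong refl) (auto simp: when_def dest: assms(3))
  also have "\<dots> = lookup f \<mu> * lookup g \<nu>"
    using assms(1,2) by simp
  finally show ?thesis .
qed

section \<open>Weighted degrees and uniquely attained sums of exponents\<close>

definition wdeg :: "('x::finite \<Rightarrow> nat) \<Rightarrow> ('x \<Rightarrow>\<^sub>0 nat) \<Rightarrow> nat" where
  "wdeg w m = (\<Sum>x\<in>UNIV. w x * lookup m x)"

lemma wdeg_0 [simp]: "wdeg w 0 = 0"
  by (simp add: wdeg_def)

lemma wdeg_add: "wdeg w (m + n) = wdeg w m + wdeg w n"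
  by (simp add: wdeg_def lookup_add distrib_left sum.distrib)

lemma wdeg_single: "wdeg w (single x k) = w x * k"
  by (simp add: wdeg_def lookup_single when_def if_distrib sum.delta cong: if_cong)

lemma monom_degree_eq_wdeg: "monom_degree m = wdeg (\<lambda>_. 1) m"
  unfolding monom_degree_def wdeg_def
  by (simp, rule sum.mono_neutral_left) (auto simp: in_keys_iff)

text \<open>
  Successively minimising the weight and the exponents of the variables yields vertices of the two
  Newton polytopes whose sum is attained only once in the product.
\<close>

lemma ex_unique_sum_min_wdeg:
  fixes A B :: "('x::finite \<Rightarrow>\<^sub>0 nat) set"
  assumes "A \<noteq> {}" "B \<noteq> {}"
  shows "\<exists>\<alpha>\<in>A. \<exists>\<beta>\<in>B. (\<forall>\<alpha>'\<in>A. wdeg w \<alpha> \<le> wdeg w \<alpha>') \<and> (\<forall>\<beta>'\<in>B. wdeg w \<beta> \<le> wdeg w \<beta>') \<and>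
    (\<forall>\<alpha>'\<in>A. \<forall>\<beta>'\<in>B. \<alpha>' + \<beta>' = \<alpha> + \<beta> \<longrightarrow> \<alpha>' = \<alpha> \<and> \<beta>' = \<beta>)"
proof -
  \<comment> \<open>\<open>face A' B'\<close> says that every way of writing an element of
    \<open>A' + B'\<close> as a sum from \<open>A\<close> and \<open>B\<close> stays inside
    \<open>A'\<close> and \<open>B'\<close>. Minimising an additive function on both sides preserves
    this: if a sum of two minima is attained, neither summand can exceed its own minimum.\<close>
  define face where "face = (\<lambda>A' B'. A' \<subseteq> A \<and> B' \<subseteq> B \<and> A' \<noteq> {} \<and> B' \<noteq> {} \<and>
     (\<forall>\<alpha>\<in>A. \<forall>\<beta>\<in>B. \<forall>\<alpha>'\<in>A'. \<forall>\<beta>'\<in>B'. \<alpha> + \<beta> = \<alpha>' + \<beta>' \<longrightarrow> \<alpha> \<in> A' \<and> \<beta> \<in> B'))"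
  define mins where "mins = (\<lambda>(h :: ('x \<Rightarrow>\<^sub>0 nat) \<Rightarrow> nat) S. {\<alpha>\<in>S. \<forall>\<alpha>'\<in>S. h \<alpha> \<le> h \<alpha>'})"
  have mins_ne: "mins h S \<noteq> {}" if S: "S \<noteq> {}" for h :: "('x \<Rightarrow>\<^sub>0 nat) \<Rightarrow> nat" and S
  proof -
    obtain y where "y \<in> S" "\<And>z. z \<in> S \<Longrightarrow> h y \<le> h z"
      using S ex_has_least_nat[of "\<lambda>y. y \<in> S" _ h] by blast
    then show ?thesis unfolding mins_def by blast
  qed
  have step: "face (mins h A') (mins h B')"
    if "face A' B'" and h: "\<And>m n. h (m + n) = h m + h n" for A' B' and h :: "('x \<Rightarrow>\<^sub>0 nat) \<Rightarrow> nat"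
    unfolding face_def
  proof (intro conjI ballI impI)
    fix \<alpha> \<beta> \<alpha>' \<beta>'
    assume *: "\<alpha> \<in> A" "\<beta> \<in> B" "\<alpha>' \<in> mins h A'" "\<beta>' \<in> mins h B'" "\<alpha> + \<beta> = \<alpha>' + \<beta>'"
    then have in': "\<alpha> \<in> A'" "\<beta> \<in> B'"
      using \<open>face A' B'\<close> unfolding face_def mins_def by blast+
    then have "h \<alpha>' \<le> h \<alpha>" "h \<beta>' \<le> h \<beta>" "h \<alpha> + h \<beta> = h \<alpha>' + h \<beta>'"
      using * by (auto simp: mins_def simp flip: h)
    then have "h \<alpha> = h \<alpha>'" "h \<beta> = h \<beta>'" by auto
    then show "\<alpha> \<in> mins h A'" "\<beta> \<in> mins h B'"
      using in' * by (auto simp: mins_def)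
  qed (use that mins_ne in \<open>auto simp: face_def mins_def\<close>)
  have "\<exists>A' B'. face A' B' \<and> A' \<subseteq> mins (wdeg w) A \<and> B' \<subseteq> mins (wdeg w) B \<and>
      (\<forall>x\<in>S. \<forall>\<alpha>\<in>A'. \<forall>\<alpha>'\<in>A'. lookup \<alpha> x = lookup \<alpha>' x) \<and>
      (\<forall>x\<in>S. \<forall>\<alpha>\<in>B'. \<forall>\<alpha>'\<in>B'. lookup \<alpha> x = lookup \<alpha>' x)" for S :: "'x set"
    using finite[of S]
  proof (induction S)
    case empty
    have "face A B" using assms by (simp add: face_def)
    then have "face (mins (wdeg w) A) (mins (wdeg w) B)" by (rule step) (simp add: wdeg_add)
    then show ?case by blast
  next
    case (insert x S)
    then obtain A' B' where *: "face A' B'" "A' \<subseteq> mins (wdeg w) A" "B' \<subseteq> mins (wdeg w) B"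
      "\<forall>x\<in>S. \<forall>\<alpha>\<in>A'. \<forall>\<alpha>'\<in>A'. lookup \<alpha> x = lookup \<alpha>' x"
      "\<forall>x\<in>S. \<forall>\<alpha>\<in>B'. \<forall>\<alpha>'\<in>B'. lookup \<alpha> x = lookup \<alpha>' x" by blast
    let ?h = "\<lambda>m. lookup m x"
    have 1: "face (mins ?h A') (mins ?h B')" using *(1) by (rule step) (simp add: lookup_add)
    have "mins ?h S' \<subseteq> S'" for S' by (auto simp: mins_def)
    then have 2: "mins ?h A' \<subseteq> mins (wdeg w) A" "mins ?h B' \<subseteq> mins (wdeg w) B"
      using *(2,3) by (meson subset_trans)+
    have 3: "\<forall>z\<in>insert x S. \<forall>\<alpha>\<in>mins ?h S'. \<forall>\<alpha>'\<in>mins ?h S'. lookup \<alpha> z = lookup \<alpha>' z"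
      if "\<forall>z\<in>S. \<forall>\<alpha>\<in>S'. \<forall>\<alpha>'\<in>S'. lookup \<alpha> z = lookup \<alpha>' z" for S'
      using that by (auto simp: mins_def intro: antisym)
    show ?case using 1 2 3[OF *(4)] 3[OF *(5)] by (intro exI conjI)
  qed
  from this[of UNIV] obtain A' B' where
    *: "face A' B'" "A' \<subseteq> mins (wdeg w) A" "B' \<subseteq> mins (wdeg w) B"
      "\<forall>x. \<forall>\<alpha>\<in>A'. \<forall>\<alpha>'\<in>A'. lookup \<alpha> x = lookup \<alpha>' x"
      "\<forall>x. \<forall>\<alpha>\<in>B'. \<forall>\<alpha>'\<in>B'. lookup \<alpha> x = lookup \<alpha>' x"
    by auto
  have single: "\<And>\<alpha> \<alpha>'. \<alpha> \<in> A' \<Longrightarrow> \<alpha>' \<in> A' \<Longrightarrow> \<alpha> = \<alpha>'" "\<And>\<alpha> \<alpha>'. \<alpha> \<in> B' \<Longrightarrow> \<alpha>' \<in> B' \<Longrightarrow> \<alpha> = \<alpha>'"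
    using *(4,5) by (intro poly_mapping_eqI; blast)+
  obtain \<alpha> \<beta> where ab: "\<alpha> \<in> A'" "\<beta> \<in> B'" using *(1) unfolding face_def by blast
  have "\<alpha>' = \<alpha> \<and> \<beta>' = \<beta>" if "\<alpha>' \<in> A" "\<beta>' \<in> B" "\<alpha>' + \<beta>' = \<alpha> + \<beta>" for \<alpha>' \<beta>'
    using that ab *(1) single unfolding face_def by blast
  moreover have "\<alpha> \<in> A" "\<beta> \<in> B" "\<forall>\<alpha>'\<in>A. wdeg w \<alpha> \<le> wdeg w \<alpha>'" "\<forall>\<beta>'\<in>B. wdeg w \<beta> \<le> wdeg w \<beta>'"
    using ab *(2,3) by (auto simp: mins_def)
  ultimately show ?thesis by blast
qed

text \<open>The least weight behaves like a valuation: the product has a monomial whose weight is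
  the sum of the two least weights, and its coefficient is a single product of nonzero elements of a
  domain.\<close>

lemma ex_key_mult_min_wdeg:
  fixes f g :: "('x::finite, 'k::idom) mpoly"
  assumes "f \<noteq> 0" "g \<noteq> 0"
  obtains \<mu> \<nu> where "\<mu> \<in> keys f" "\<nu> \<in> keys g" "\<mu> + \<nu> \<in> keys (f * g)"
    "\<And>\<mu>'. \<mu>' \<in> keys f \<Longrightarrow> wdeg w \<mu> \<le> wdeg w \<mu>'" "\<And>\<nu>'. \<nu>' \<in> keys g \<Longrightarrow> wdeg w \<nu> \<le> wdeg w \<nu>'"
proof -
  have "keys f \<noteq> {}" "keys g \<noteq> {}"
    using assms by (metis poly_mapping_sum_monomials sum.empty)+
  from ex_unique_sum_min_wdeg[OF this, of w] obtain \<mu> \<nu> where *: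
    "\<mu> \<in> keys f" "\<nu> \<in> keys g" "\<forall>\<mu>'\<in>keys f. wdeg w \<mu> \<le> wdeg w \<mu>'" "\<forall>\<nu>'\<in>keys g. wdeg w \<nu> \<le> wdeg w \<nu>'"
    "\<And>\<mu>' \<nu>'. \<mu>' \<in> keys f \<Longrightarrow> \<nu>' \<in> keys g \<Longrightarrow> \<mu>' + \<nu>' = \<mu> + \<nu> \<Longrightarrow> \<mu>' = \<mu> \<and> \<nu>' = \<nu>" by blast
  have "lookup (f * g) (\<mu> + \<nu>) = lookup f \<mu> * lookup g \<nu>"
    using *(1,2,5) by (rule lookup_mult_unique)
  then have "\<mu> + \<nu> \<in> keys (f * g)" using *(1,2) by (simp add: in_keys_iff)
  with * show thesis by (intro that[of \<mu> \<nu>]) auto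
qed

section \<open>Polynomials as functions over an infinite field\<close>

lemma infinite_alg_closed_field: "infinite (UNIV :: 'k::alg_closed_field set)"
proof
  assume fin: "finite (UNIV :: 'k set)"
  \<comment> \<open>As in Euclid's argument for primes: one plus the product of all
    \<open>X - a\<close> takes the value 1 everywhere, yet has positive degree.\<close>
  define p :: "'k poly" where "p = 1 + (\<Prod>a\<in>UNIV. [:- a, 1:])"
  have deg: "degree (\<Prod>a\<in>(UNIV::'k set). [:- a, 1:]) = card (UNIV :: 'k set)"
    by (subst degree_prod_eq_sum_degree) auto
  have "card (UNIV :: 'k set) > 0"
    using fin by (simp add: card_gt_0_iff)
  then have "degree p > 0"
    unfolding p_def using deg by (subst degree_add_eq_right) auto
  then obtain x where "poly p x = 0" using alg_closed_imp_poly_has_root by blast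
  moreover have "poly p x = 1"
    using fin by (simp add: p_def poly_prod)
  ultimately show False by simp
qed

text \<open>Freezing all variables but one leaves a univariate polynomial with infinitely many
  roots, so its coefficients vanish, and these are polynomial functions in fewer variables.
  Exponents are total functions required to differ on \<open>S\<close>, so the induction over
  \<open>S\<close> never changes the type of variables.\<close>

lemma vanishing_coefficients_of_vanishing_function:
  fixes c :: "('x \<Rightarrow> nat) \<Rightarrow> 'k::field"
  assumes "infinite (UNIV :: 'k set)" "finite S" "finite K"
    and "inj_on (\<lambda>m. restrict m S) K"
    and "\<And>a. (\<Sum>m\<in>K. c m * (\<Prod>x\<in>S. a x ^ m x)) = 0"
  shows "\<forall>m\<in>K. c m = 0"
  using assms(2-)
proof (induction S arbitrary: K rule: finite_induct)
  case empty
  show ?case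
  proof
    fix m assume "m \<in> K"
    then have "K = {m}" using empty.prems(2) by (auto simp: inj_on_def)
    then show "c m = 0" using empty.prems(3) by simp
  qed
next
  case (insert x S)
  show ?case
  proof
    fix m assume m: "m \<in> K"
    \<comment> \<open>The exponents contributing to the coefficient of the power \<open>m x\<close>
      of the split-off variable; as they agree at \<open>x\<close>, they must already differ on
      \<open>S\<close>.\<close>
    define L where "L = {m'\<in>K. m' x = m x}"
    have sum0: "(\<Sum>m'\<in>L. c m' * (\<Prod>y\<in>S. a y ^ m' y)) = 0" for a
    proof -
      define d where "d m' = c m' * (\<Prod>y\<in>S. a y ^ m' y)" for m'
      define p where "p = (\<Sum>m'\<in>K. Polynomial.monom (d m') (m' x))"
      have "poly p T = 0" for T
      proof -
        have "(\<Prod>y\<in>insert x S. (a(x := T)) y ^ m' y) = T ^ m' x * (\<Prod>y\<in>S. a y ^ m' y)" for m'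
          using insert.hyps by (simp, intro disjI2 prod.cong) auto
        then show ?thesis
          using insert.prems(3)[of "a(x := T)"]
          by (simp add: p_def d_def poly_sum poly_monom mult_ac)
      qed
      then have "p = 0" using assms(1) poly_roots_finite[of p] by auto
      then have "coeff p (m x) = 0" by simp
      moreover have "coeff p (m x) = (\<Sum>m'\<in>K. if m' x = m x then d m' else 0)"
        by (simp add: p_def coeff_sum)
      ultimately show ?thesis
        using insert.prems(1) by (simp add: L_def sum.inter_filter flip: d_def)
    qed
    have injL: "inj_on (\<lambda>m. restrict m S) L"
    proof (rule inj_onI)
      fix m1 m2 assume *: "m1 \<in> L" "m2 \<in> L" "restrict m1 S = restrict m2 S"
      have "m1 y = m2 y" if "y \<in> insert x S" for y
        using that *(1,2) fun_cong[OF *(3), of y] by (cases "y = x") (auto simp: L_def)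
      then have "restrict m1 (insert x S) = restrict m2 (insert x S)" by auto
      moreover have "m1 \<in> K" "m2 \<in> K" using *(1,2) by (simp_all add: L_def)
      ultimately show "m1 = m2" by (rule inj_onD[OF insert.prems(2)])
    qed
    have "finite L" using insert.prems(1) by (simp add: L_def)
    then have "\<forall>m\<in>L. c m = 0" using injL sum0 by (rule insert.IH)
    then show "c m = 0" using m by (simp add: L_def)
  qed
qed

lemma mpoly_eq_0_if_eval_eq_0:
  fixes f :: "('x::finite, 'k::field) mpoly"
  assumes "infinite (UNIV :: 'k set)" "\<And>a. mpoly_eval f a = 0"
  shows "f = 0"
proof -
  have inj: "inj_on lookup (keys f)" by (simp add: inj_on_def lookup_inject)
  let ?inv = "inv_into (keys f) lookup"
  have "\<forall>m\<in>lookup ` keys f. lookup f (?inv m) = 0"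
  proof (rule vanishing_coefficients_of_vanishing_function[OF assms(1) finite[of UNIV]])
    show "(\<Sum>m\<in>lookup ` keys f. lookup f (?inv m) * (\<Prod>x\<in>UNIV. a x ^ m x)) = 0" for a
    proof -
      have "(\<Sum>m\<in>lookup ` keys f. lookup f (?inv m) * (\<Prod>x\<in>UNIV. a x ^ m x)) = mpoly_eval f a"
        unfolding mpoly_eval_def
        by (subst sum.reindex[OF inj])
           (auto intro!: sum.cong simp: inj prod_power_keys_superset[OF finite[of UNIV]])
      then show ?thesis using assms(2) by simp
    qed
  qed (auto intro!: inj_onI simp: lookup_inject restrict_UNIV)
  then have "lookup f m = 0" if "m \<in> keys f" for m using that inj by auto
  then show ?thesis by (metis in_keys_iff poly_mapping_eqI lookup_zero)
qed

lemma mpoly_eqI_eval: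
  fixes f g :: "('x::finite, 'k::alg_closed_field) mpoly"
  assumes "\<And>a. mpoly_eval f a = mpoly_eval g a"
  shows "f = g"
  using mpoly_eq_0_if_eval_eq_0[of "f - g"] infinite_alg_closed_field assms
  by (simp add: mpoly_eval_diff)

section \<open>Ideals cut out by a weighted degree\<close>

definition weight_filtration :: "('x::finite \<Rightarrow> nat) \<Rightarrow> nat \<Rightarrow> ('x, 'k::comm_ring_1) mpoly set" where
  "weight_filtration w d = {f. \<forall>m\<in>keys f. d \<le> wdeg w m}"

lemma wdeg_weight_add: "wdeg (\<lambda>x. w x + w' x) m = wdeg w m + wdeg w' m"
  by (simp add: wdeg_def distrib_right sum.distrib)

lemma wdeg_weight_sum: "wdeg (\<lambda>x. \<Sum>i\<in>A. w i x) m = (\<Sum>i\<in>A. wdeg (w i) m)"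
  unfolding wdeg_def by (subst sum.swap) (simp add: sum_distrib_right)

lemma wdeg_weight_mult: "wdeg (\<lambda>x. c * w x) m = c * wdeg w m"
  by (simp add: wdeg_def sum_distrib_left mult.assoc)

lemma wdeg_weight_mono: "(\<And>x. w x \<le> w' x) \<Longrightarrow> wdeg w m \<le> wdeg w' m"
  by (simp add: wdeg_def sum_mono)

lemma wdeg_pos_iff: "0 < wdeg w m \<longleftrightarrow> (\<exists>x\<in>keys m. 0 < w x)"
proof -
  have "wdeg w m = 0 \<longleftrightarrow> (\<forall>x. w x = 0 \<or> lookup m x = 0)" by (simp add: wdeg_def)
  then show ?thesis by (metis gr0I less_numeral_extra(3) in_keys_iff)
qed

lemma wdeg_sum: "wdeg w (sum g A) = (\<Sum>i\<in>A. wdeg w (g i))"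
  by (induction A rule: infinite_finite_induct) (simp_all add: wdeg_add)

lemma keys_mult_single:
  assumes "m \<in> keys (single a c * f)" obtains n where "n \<in> keys f" "m = a + n"
proof -
  have "m \<in> {p + q |p q. p \<in> keys (single a c) \<and> q \<in> keys f}"
    using assms keys_mult[of "single a c" f] by blast
  then show thesis using that by (auto split: if_splits)
qed

lemma ring_ideal_weight_filtration: "ring_ideal (weight_filtration w d)"
  unfolding ring_ideal_iff weight_filtration_def
proof (intro conjI ballI allI CollectI)
  fix f g :: "('a, 'b) mpoly" and m
  assume "f \<in> {f. \<forall>m\<in>keys f. d \<le> wdeg w m}" "g \<in> {f. \<forall>m\<in>keys f. d \<le> wdeg w m}" "m \<in> keys (f + g)"
  then show "d \<le> wdeg w m" using Poly_Mapping.keys_add[of f g] by auto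
next
  fix c f :: "('a, 'b) mpoly" and m
  assume f: "f \<in> {f. \<forall>m\<in>keys f. d \<le> wdeg w m}" and "m \<in> keys (c * f)"
  then obtain a b where "b \<in> keys f" "m = a + b" using keys_mult[of c f] by blast
  then show "d \<le> wdeg w m" using f by (simp add: wdeg_add trans_le_add2)
qed auto

lemma weight_filtration_mult:
  assumes "f \<in> weight_filtration w d" "g \<in> weight_filtration w e"
  shows "f * g \<in> weight_filtration w (d + e)"
  unfolding weight_filtration_def
proof (intro CollectI ballI)
  fix m assume "m \<in> keys (f * g)"
  then obtain a b where "a \<in> keys f" "b \<in> keys g" "m = a + b" using keys_mult[of f g] by blast
  then show "d + e \<le> wdeg w m"
    using assms by (simp add: weight_filtration_def wdeg_add add_mono)
qed

lemma ideal_pow_subset_weight_filtration: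
  assumes "J \<subseteq> weight_filtration w d"
  shows "ideal_pow J r \<subseteq> weight_filtration w (r * d)"
proof (induction r)
  case 0
  then show ?case by (simp add: weight_filtration_def)
next
  case (Suc r)
  have "a * b \<in> weight_filtration w (Suc r * d)" if "a \<in> J" "b \<in> ideal_pow J r" for a b
    using weight_filtration_mult[of a w d b "r * d"] that assms Suc by auto
  then show ?case
    by (simp add: ideal_mult_least ring_ideal_weight_filtration)
qed

lemma single_in_weight_filtration_iff:
  "single m 1 \<in> weight_filtration w d \<longleftrightarrow> d \<le> wdeg w m"
  by (simp add: weight_filtration_def)

lemma mem_ideal_if_monomials:
  assumes "ring_ideal J" "\<And>m. m \<in> keys f \<Longrightarrow> single m 1 \<in> J"
  shows "f \<in> J"
proof -
  have "single m (lookup f m) \<in> J" if "m \<in> keys f" for m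
    using ring_ideal_mult[OF assms(1) assms(2)[OF that], of "single 0 (lookup f m)"]
    by (simp add: mult_single)
  then show ?thesis
    using ring_ideal_sum[OF assms(1), of "keys f" "\<lambda>m. single m (lookup f m)"]
    by (simp add: poly_mapping_sum_monomials)
qed

text \<open>Since \<open>u\<close> has a monomial of weight 0, its least weight is 0, so
  \<open>u * f\<close> and \<open>f\<close> have the same least weight. For \<open>d = 1\<close>
  this is primality; for larger \<open>d\<close> it allows denominators outside that prime to be
  cancelled.\<close>

lemma weight_filtration_cancel:
  fixes f u :: "('x::finite, 'k::idom) mpoly"
  assumes "u \<notin> weight_filtration w 1" "u * f \<in> weight_filtration w d"
  shows "f \<in> weight_filtration w d"
proof (cases "f = 0")
  case False
  obtain \<kappa> where \<kappa>: "\<kappa> \<in> keys u" "wdeg w \<kappa> = 0"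
    using assms(1) by (auto simp: weight_filtration_def not_le)
  then have "u \<noteq> 0" by auto
  from ex_key_mult_min_wdeg[OF this False, of w] obtain \<mu> \<nu> where *:
    "\<mu> + \<nu> \<in> keys (u * f)" "\<And>\<mu>'. \<mu>' \<in> keys u \<Longrightarrow> wdeg w \<mu> \<le> wdeg w \<mu>'"
    "\<And>\<nu>'. \<nu>' \<in> keys f \<Longrightarrow> wdeg w \<nu> \<le> wdeg w \<nu>'" by metis
  have "d \<le> wdeg w \<nu>"
    using *(1) *(2)[OF \<kappa>(1)] \<kappa>(2) assms(2) by (auto simp: weight_filtration_def wdeg_add)
  then show ?thesis
    using *(3) by (auto simp: weight_filtration_def intro: order_trans)
qed (simp add: weight_filtration_def)

lemma ring_prime_ideal_weight_filtration:
  "ring_prime_ideal (weight_filtration w 1 :: ('x::finite, 'k::idom) mpoly set)"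
  unfolding ring_prime_ideal_def
proof (intro conjI allI impI)
  show "weight_filtration w 1 \<noteq> (UNIV :: ('x, 'k) mpoly set)"
    using single_in_weight_filtration_iff[of 0 w 1, where ?'b = 'k] by force
qed (use ring_ideal_weight_filtration weight_filtration_cancel in blast)+

lemma ring_prime_ideal_prod:
  assumes "ring_prime_ideal P" "finite S" "prod g S \<in> P"
  obtains i where "i \<in> S" "g i \<in> P"
  using assms(2,3)
proof (induction S arbitrary: thesis rule: finite_induct)
  case empty
  then show ?case using ring_prime_ideal_1[OF assms(1)] by simp
next
  case (insert x S)
  then show ?case using ring_prime_idealD(3)[OF assms(1)] by (metis insert_iff prod.insert)
qed

text \<open>Otherwise each \<open>Q i\<close> has an element outside \<open>P\<close>; the product
  of these lies in every \<open>Q i\<close>, hence in \<open>P\<close>, against primality. The empty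
  intersection is excluded by the same argument, as the empty product is 1.\<close>

lemma ring_prime_ideal_eq_Inter:
  assumes P: "ring_prime_ideal P" and "finite S" "P = (\<Inter>i\<in>S. Q i)" "\<And>i. i \<in> S \<Longrightarrow> ring_ideal (Q i)"
  shows "\<exists>i\<in>S. P = Q i"
proof (rule ccontr)
  assume "\<not> ?thesis"
  then have "\<forall>i\<in>S. \<exists>g. g \<in> Q i \<and> g \<notin> P" using assms(3) by blast
  then obtain g where g: "\<And>i. i \<in> S \<Longrightarrow> g i \<in> Q i" "\<And>i. i \<in> S \<Longrightarrow> g i \<notin> P" by metis
  have "prod g S \<in> Q i" if "i \<in> S" for i
    using ring_ideal_mult[OF assms(4)[OF that] g(1)[OF that], of "prod g (S - {i})"] that assms(2)
    by (simp add: prod.remove[of S i] mult.commute)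
  then have "prod g S \<in> P" using assms(3) by blast
  then show False using ring_prime_ideal_prod[OF P assms(2)] g(2) by blast
qed

lemma monom_degree_le_mpoly_degree: "m \<in> keys f \<Longrightarrow> monom_degree m \<le> mpoly_degree f"
  by (simp add: mpoly_degree_def)

lemma mpoly_degree_single [simp]: "mpoly_degree (single m (1 :: 'k::comm_ring_1)) = monom_degree m"
  by (simp add: mpoly_degree_def)

lemma keys_nonempty: "f \<noteq> 0 \<Longrightarrow> keys f \<noteq> {}"
  by simp

lemma alpha_le: "f \<in> J \<Longrightarrow> f \<noteq> 0 \<Longrightarrow> alpha J \<le> mpoly_degree f"
  unfolding alpha_def by (rule Least_le) blast

text \<open>The element \<open>f\<close> certifies that \<open>LEAST\<close> ranges over a nonempty
  set; otherwise its value would be unspecified. The bound is asked of single monomials, which is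
  how the weight conditions supply it.\<close>

lemma alpha_ge:
  assumes "f \<in> J" "f \<noteq> 0" "\<And>f m. f \<in> J \<Longrightarrow> m \<in> keys f \<Longrightarrow> d \<le> monom_degree m"
  shows "d \<le> alpha J"
proof -
  obtain g where g: "g \<in> J" "g \<noteq> 0" "mpoly_degree g = alpha J"
    using LeastI_ex[of "\<lambda>d. \<exists>f\<in>J. f \<noteq> 0 \<and> mpoly_degree f = d"] assms(1,2)
    unfolding alpha_def by blast
  then obtain m where "m \<in> keys g" using keys_nonempty[of g] by blast
  then show ?thesis
    using assms(3)[OF g(1)] monom_degree_le_mpoly_degree[of m g] g(3) by fastforce
qed

lemma poly_mapping_remove1:
  assumes "x \<in> keys m"
  obtains m' where "m = single x (1::nat) + m'"
proof
  show "m = single x 1 + (m - single x 1)"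
    using assms unfolding in_keys_iff
    by (intro poly_mapping_eqI) (auto simp: lookup_add lookup_minus lookup_single when_def)
qed

section \<open>The ideal of coordinate subspaces\<close>

text \<open>
  Variables \<open>x\<close> with \<open>b x = i < s\<close> are coordinates on the \<open>i\<close>-th subspace; those with \<open>b x \<ge> s\<close>
  vanish on all subspaces.
\<close>

locale coordinate_blocks =
  fixes s :: nat and b :: "'x::finite \<Rightarrow> nat" and ty :: "'k::field itself"
  assumes s_pos: "0 < s" and block_nonempty: "i < s \<Longrightarrow> \<exists>x. b x = i"
begin

text \<open>The weight 1 variables are those vanishing on the \<open>i\<close>-th subspace, so
  \<open>weight_filtration (outside i) m\<close> is the \<open>m\<close>-th power of the prime of
  that subspace.\<close>

definition outside :: "nat \<Rightarrow> 'x \<Rightarrow> nat" where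
  "outside i x = (if b x = i then 0 else 1)"

text \<open>With these weights every monomial generator of the block ideal has weight exactly 2.\<close>

definition generator_weight :: "'x \<Rightarrow> nat" where
  "generator_weight x = (if b x < s then 1 else 2)"

definition block_power :: "nat \<Rightarrow> ('x, 'k) mpoly set" where
  "block_power m = (\<Inter>i<s. weight_filtration (outside i) m)"

abbreviation block_ideal :: "('x, 'k) mpoly set" where
  "block_ideal \<equiv> block_power 1"

lemma wdeg_outside_single [simp]: "wdeg (outside i) (single x k) = (if b x = i then 0 else k)"
  by (simp add: outside_def wdeg_single)

lemma wdeg_generator_weight_single [simp]:
  "wdeg generator_weight (single x k) = (if b x < s then k else 2 * k)"
  by (simp add: generator_weight_def wdeg_single)

lemma block_power_iff:
  "f \<in> block_power m \<longleftrightarrow> (\<forall>\<mu>\<in>keys f. \<forall>i<s. m \<le> wdeg (outside i) \<mu>)"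
  by (auto simp: block_power_def weight_filtration_def)

lemma single_in_block_power_iff:
  "single \<mu> 1 \<in> block_power m \<longleftrightarrow> (\<forall>i<s. m \<le> wdeg (outside i) \<mu>)"
  by (simp add: block_power_iff)

lemma ring_ideal_block_power: "ring_ideal (block_power m)"
  unfolding block_power_def ring_ideal_def
  by (intro module.subspace_Int[OF module_mult])
     (rule ring_ideal_weight_filtration[unfolded ring_ideal_def])

text \<open>A monomial vanishes on all the subspaces iff it involves a variable off all blocks or
  variables of two different blocks; these are the minimal such monomials.\<close>

definition generator_monomials :: "('x \<Rightarrow>\<^sub>0 nat) set" where
  "generator_monomials = {single y 1 | y. s \<le> b y} \<union>
     {single x 1 + single z 1 | x z. b x < s \<and> b z < s \<and> b x \<noteq> b z}"

lemma wdeg_generator_monomial: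
  "\<kappa> \<in> generator_monomials \<Longrightarrow> wdeg generator_weight \<kappa> = 2"
  by (auto simp: generator_monomials_def wdeg_add)

lemma generator_monomial_in_block_ideal:
  "\<kappa> \<in> generator_monomials \<Longrightarrow> single \<kappa> 1 \<in> block_ideal"
  by (auto simp: generator_monomials_def single_in_block_power_iff wdeg_add)

text \<open>Start from any variable \<open>x\<close> of the monomial. If it belongs to a block, the
  condition for that very block supplies a variable \<open>z\<close> outside it; then
  \<open>z\<close> alone or the product of both is a generator, according to whether
  \<open>z\<close> is off all blocks.\<close>

lemma block_ideal_monomial_factor:
  assumes "f \<in> block_ideal" "\<mu> \<in> keys f"
  obtains \<kappa> \<nu> where "\<kappa> \<in> generator_monomials" "\<mu> = \<kappa> + \<nu>"
proof -
  have out: "\<exists>x\<in>keys \<mu>. b x \<noteq> i" if "i < s" for i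
  proof -
    have "0 < wdeg (outside i) \<mu>" using assms that by (force simp: block_power_iff)
    then show ?thesis unfolding wdeg_pos_iff by (auto simp: outside_def split: if_splits)
  qed
  then obtain x where x: "x \<in> keys \<mu>" using s_pos by blast
  from x obtain \<mu>' where \<mu>': "\<mu> = single x 1 + \<mu>'" by (rule poly_mapping_remove1)
  show thesis
  proof (cases "b x < s")
    case True
    then obtain z where z: "z \<in> keys \<mu>" "b z \<noteq> b x" using out by blast
    show thesis
    proof (cases "b z < s")
      case z_lt: True
      have "z \<noteq> x" using z(2) by auto
      then have "z \<in> keys \<mu>'"
        using z(1) unfolding \<mu>' in_keys_iff by (simp add: lookup_add lookup_single)
      then obtain \<nu> where \<nu>: "\<mu>' = single z 1 + \<nu>" by (rule poly_mapping_remove1)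
      have "single x 1 + single z 1 \<in> generator_monomials"
        using True z_lt z(2) unfolding generator_monomials_def by force
      then show thesis using that[of _ \<nu>] by (simp add: \<mu>' \<nu> add.assoc)
    next
      case False
      from z(1) obtain \<nu> where "\<mu> = single z 1 + \<nu>" by (rule poly_mapping_remove1)
      moreover have "single z 1 \<in> generator_monomials"
        using False unfolding generator_monomials_def by force
      ultimately show thesis using that by blast
    qed
  next
    case False
    then have "single x 1 \<in> generator_monomials" unfolding generator_monomials_def by force
    then show thesis using that \<mu>' by blast
  qed
qed

lemma block_ideal_eq_ideal_gen: "block_ideal = ideal_gen ((\<lambda>\<kappa>. single \<kappa> 1) ` generator_monomials)"
proof
  show "ideal_gen ((\<lambda>\<kappa>. single \<kappa> 1) ` generator_monomials) \<subseteq> block_ideal"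
    using generator_monomial_in_block_ideal ring_ideal_block_power
    by (intro ideal_gen_least) auto
  show "block_ideal \<subseteq> ideal_gen ((\<lambda>\<kappa>. single \<kappa> 1) ` generator_monomials)"
  proof
    fix f assume f: "f \<in> block_ideal"
    show "f \<in> ideal_gen ((\<lambda>\<kappa>. single \<kappa> 1) ` generator_monomials)"
    proof (rule mem_ideal_if_monomials[OF ring_ideal_ideal_gen])
      fix \<mu> assume "\<mu> \<in> keys f"
      with f obtain \<kappa> \<nu> where *: "\<kappa> \<in> generator_monomials" "\<mu> = \<kappa> + \<nu>"
        by (rule block_ideal_monomial_factor)
      have "single \<nu> 1 * single \<kappa> (1 :: 'k) \<in> ideal_gen ((\<lambda>\<kappa>. single \<kappa> 1) ` generator_monomials)"
        using *(1) by (intro ring_ideal_mult[OF ring_ideal_ideal_gen] ideal_gen_base) auto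
      then show "single \<mu> 1 \<in> ideal_gen ((\<lambda>\<kappa>. single \<kappa> (1 :: 'k)) ` generator_monomials)"
        by (simp add: *(2) mult_single add.commute)
    qed
  qed
qed

lemma block_ideal_subset_generator_weight: "block_ideal \<subseteq> weight_filtration generator_weight 2"
  unfolding block_ideal_eq_ideal_gen
  by (intro ideal_gen_least ring_ideal_weight_filtration)
     (auto simp: single_in_weight_filtration_iff wdeg_generator_monomial)

lemma ideal_pow_block_ideal_subset:
  "ideal_pow block_ideal r \<subseteq> weight_filtration generator_weight (2 * r)"
  using ideal_pow_subset_weight_filtration[OF block_ideal_subset_generator_weight, of r]
  by (simp add: mult.commute)

text \<open>
  A monomial satisfying the two inequalities is peeled off by a variable outside all blocks, or else
  by a variable of a block of maximal degree together with one of another block.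
\<close>

lemma single_in_ideal_pow_block_ideal:
  assumes "\<And>i. i < s \<Longrightarrow> r \<le> wdeg (outside i) \<mu>" "2 * r \<le> wdeg generator_weight \<mu>"
  shows "single \<mu> 1 \<in> ideal_pow block_ideal r"
  using assms
proof (induction r arbitrary: \<mu>)
  case 0
  then show ?case by simp
next
  case (Suc r)
  have mult: "single (\<kappa> + \<nu>) 1 \<in> ideal_pow block_ideal (Suc r)"
    if "\<And>i. i < s \<Longrightarrow> 1 \<le> wdeg (outside i) \<kappa>" "\<And>i. i < s \<Longrightarrow> r \<le> wdeg (outside i) \<nu>"
      "2 * r \<le> wdeg generator_weight \<nu>" for \<kappa> \<nu>
  proof -
    have "single \<kappa> 1 * single \<nu> 1 \<in> ideal_mult block_ideal (ideal_pow block_ideal r)"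
      using that Suc.IH by (intro ideal_multI) (simp_all add: single_in_block_power_iff)
    then show ?thesis by (simp add: mult_single)
  qed
  show ?case
  proof (cases "\<exists>y\<in>keys \<mu>. b y \<ge> s")
    case True
    then obtain y \<nu> where y: "b y \<ge> s" "\<mu> = single y 1 + \<nu>"
      using poly_mapping_remove1 by metis
    show ?thesis unfolding y(2)
    proof (rule mult)
      show "r \<le> wdeg (outside i) \<nu>" if "i < s" for i
        using Suc.prems(1)[OF that] y that by (simp add: wdeg_add)
      show "2 * r \<le> wdeg generator_weight \<nu>"
        using Suc.prems(2) y by (simp add: wdeg_add)
    qed (use y in \<open>simp add: outside_def\<close>)
  next
    case False
    define a where "a i = wdeg (\<lambda>x. if b x = i then 1 else 0) \<mu>" for i
    define A where "A = wdeg (\<lambda>_. 1) \<mu>"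
    have split: "wdeg (outside i) \<mu> + a i = A" for i
      unfolding A_def a_def wdeg_weight_add[symmetric]
      by (rule arg_cong[of _ _ "\<lambda>w. wdeg w \<mu>"]) (auto simp: outside_def)
    have "wdeg generator_weight \<mu> = A"
      unfolding A_def wdeg_def using False
      by (intro sum.cong refl) (metis generator_weight_def in_keys_iff mult_eq_0_iff not_le)
    then have A: "2 * Suc r \<le> A" using Suc.prems(2) by simp
    have a_pos: "0 < a i \<longleftrightarrow> (\<exists>x\<in>keys \<mu>. b x = i)" for i
      unfolding a_def wdeg_pos_iff by auto
    obtain i where i: "i < s" "\<And>j. j < s \<Longrightarrow> a j \<le> a i"
      using obtains_MAX[of "{..<s}" a] s_pos
      by (metis Max_ge finite_imageI finite_lessThan imageI lessThan_empty_iff lessThan_iff not_gr0)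
    have out: "\<exists>z\<in>keys \<mu>. b z \<noteq> j" if "j < s" for j
    proof -
      have "0 < wdeg (outside j) \<mu>" using Suc.prems(1)[OF that] by simp
      then show ?thesis unfolding wdeg_pos_iff by (auto simp: outside_def split: if_splits)
    qed
    obtain z where z: "z \<in> keys \<mu>" "b z \<noteq> i" using out[OF i(1)] by blast
    then have z_lt: "b z < s" using False by auto
    have "0 < a (b z)" using a_pos z(1) by blast
    then have "0 < a i" using i(2)[OF z_lt] by simp
    then obtain x where x: "x \<in> keys \<mu>" "b x = i" using a_pos by blast
    from x(1) obtain \<mu>' where \<mu>': "\<mu> = single x 1 + \<mu>'"
      by (rule poly_mapping_remove1)
    have "z \<noteq> x" using z(2) x(2) by auto
    then have "z \<in> keys \<mu>'"
      using z(1) unfolding \<mu>' in_keys_iff by (simp add: lookup_add lookup_single)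
    then obtain \<nu> where \<nu>: "\<mu>' = single z 1 + \<nu>" by (rule poly_mapping_remove1)
    have \<mu>: "\<mu> = (single x 1 + single z 1) + \<nu>" by (simp add: \<mu>' \<nu> add.assoc)
    show ?thesis unfolding \<mu>
    proof (rule mult)
      show "1 \<le> wdeg (outside k) (single x 1 + single z 1)" for k
        using x(2) z(2) by (auto simp: wdeg_add)
      show "2 * r \<le> wdeg generator_weight \<nu>"
        using Suc.prems(2) x(2) i(1) z_lt by (simp add: \<mu> wdeg_add)
      show "r \<le> wdeg (outside k) \<nu>" if "k < s" for k
      proof (cases "k = i \<or> k = b z")
        case True
        then show ?thesis
          using Suc.prems(1)[OF that] x(2) z(2) by (auto simp: \<mu> wdeg_add)
      next
        case False
        \<comment> \<open>For a third block the removed pair costs 2, so outside degree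
          \<open>r + 2\<close> is needed. If it were only \<open>r + 1\<close>, then
          \<open>a k\<close>, and by maximality \<open>a i\<close>, would be at least
          \<open>r + 1\<close>; together with \<open>a (b z) > 0\<close> this gives outside degree
          at least \<open>r + 2\<close> after all.\<close>
        have "a i + a (b z) \<le> wdeg (outside k) \<mu>"
          unfolding a_def wdeg_weight_add[symmetric]
          by (rule wdeg_weight_mono) (use False z(2) in \<open>auto simp: outside_def\<close>)
        moreover have "Suc r \<le> wdeg (outside k) \<mu>"
          by (rule Suc.prems(1)[OF that])
        ultimately have "Suc (Suc r) \<le> wdeg (outside k) \<mu>"
          using split[of k] i(2)[OF that] A \<open>0 < a (b z)\<close>
          by presburger
        then show ?thesis
          using False x(2) by (simp add: \<mu> wdeg_add)
      qed
    qed
  qed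
qed

section \<open>Associated primes and symbolic powers of the block ideal\<close>

lemma outside_le_generator_weight: "outside i x \<le> generator_weight x"
  by (simp add: outside_def generator_weight_def)

lemma ideal_pow_subset_weight_outside:
  "i < s \<Longrightarrow> ideal_pow block_ideal m \<subseteq> weight_filtration (outside i) m"
  using ideal_pow_subset_weight_filtration[of block_ideal "outside i" 1 m]
  by (auto simp: block_power_def)

text \<open>Locally at the \<open>i\<close>-th prime the block ideal becomes that prime, so the
  powers agree there. One inclusion is cancellation; for the other, a multiplier outside the prime
  must push \<open>f\<close> into the ordinary power.\<close>

lemma loc_contraction_block_ideal:
  assumes "i < s"
  shows "loc_contraction (ideal_pow block_ideal m) (weight_filtration (outside i) 1) =
    weight_filtration (outside i) m"
  unfolding loc_contraction_prime[OF ring_ideal_ideal_pow ring_prime_ideal_weight_filtration]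
proof (intro equalityI subsetI; clarify?)
  fix f u :: "('x, 'k) mpoly"
  assume "u \<notin> weight_filtration (outside i) 1" "u * f \<in> ideal_pow block_ideal m"
  then show "f \<in> weight_filtration (outside i) m"
    using weight_filtration_cancel ideal_pow_subset_weight_outside[OF assms] by blast
next
  fix f :: "('x, 'k) mpoly" assume f: "f \<in> weight_filtration (outside i) m"
  obtain x where x: "b x = i" using block_nonempty[OF assms] by blast
  \<comment> \<open>A variable of block \<open>i\<close> lies outside the \<open>i\<close>-th prime.
    Its \<open>m\<close>-th power adds \<open>m\<close> to the outside degree of every other block
    and \<open>m\<close> to the generator weight, which already is at least \<open>m\<close> on
    \<open>f\<close> and so reaches \<open>2 m\<close>.\<close>
  define u :: "('x, 'k) mpoly" where "u = single (single x m) 1"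
  have "u \<notin> weight_filtration (outside i) 1"
    using x by (simp add: u_def single_in_weight_filtration_iff outside_def)
  moreover have "u * f \<in> ideal_pow block_ideal m"
  proof (rule mem_ideal_if_monomials[OF ring_ideal_ideal_pow])
    fix \<kappa> assume "\<kappa> \<in> keys (u * f)"
    then obtain \<nu> where \<nu>: "\<nu> \<in> keys f" "\<kappa> = single x m + \<nu>"
      unfolding u_def by (rule keys_mult_single)
    have "m \<le> wdeg (outside i) \<nu>" using f \<nu>(1) by (simp add: weight_filtration_def)
    moreover from this have "m \<le> wdeg generator_weight \<nu>"
      using wdeg_weight_mono[of "outside i" generator_weight \<nu>] outside_le_generator_weight
      by (meson order_trans)
    ultimately show "single \<kappa> 1 \<in> ideal_pow block_ideal m"
      using x assms unfolding \<nu>(2)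
      by (intro single_in_ideal_pow_block_ideal)
         (auto simp: wdeg_add trans_le_add2)
  qed
  ultimately show "\<exists>u. u \<notin> weight_filtration (outside i) 1 \<and> u * f \<in> ideal_pow block_ideal m"
    by blast
qed

text \<open>The colon ideal by \<open>f\<close> is the intersection of those primes that do not
  contain \<open>f\<close>; if it is prime, it is one of them. Conversely, a variable of block
  \<open>i\<close> lies in all the primes but the \<open>i\<close>-th, so its colon ideal is exactly
  that prime.\<close>

lemma Ass_block_ideal: "Ass block_ideal = (\<lambda>i. weight_filtration (outside i) 1) ` {..<s}"
proof (intro equalityI subsetI)
  fix P assume "P \<in> Ass block_ideal"
  then obtain f where P: "ring_prime_ideal P" "P = {g. g * f \<in> block_ideal}"
    unfolding Ass_def by auto
  define S where "S = {i. i < s \<and> f \<notin> weight_filtration (outside i) 1}"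
  have "g * f \<in> weight_filtration (outside i) 1 \<longleftrightarrow>
      g \<in> weight_filtration (outside i) 1 \<or> f \<in> weight_filtration (outside i) 1" for g i
    using ring_prime_ideal_weight_filtration[of "outside i", where ?'k = 'k]
      ring_ideal_weight_filtration[of "outside i" 1, where ?'b = 'k]
    by (metis mult.commute ring_ideal_mult ring_prime_idealD(3))
  then have "P = (\<Inter>i\<in>S. weight_filtration (outside i) 1)"
    unfolding P(2) block_power_def S_def by auto
  then have "\<exists>i\<in>S. P = weight_filtration (outside i) 1"
    by (intro ring_prime_ideal_eq_Inter[OF P(1)]) (auto simp: S_def ring_ideal_weight_filtration)
  then show "P \<in> (\<lambda>i. weight_filtration (outside i) 1) ` {..<s}" by (auto simp: S_def)
next
  fix P :: "('x, 'k) mpoly set" assume "P \<in> (\<lambda>i. weight_filtration (outside i) 1) ` {..<s}"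
  then obtain i where i: "i < s" "P = weight_filtration (outside i) 1" by auto
  obtain x where x: "b x = i" using block_nonempty[OF i(1)] by blast
  define f :: "('x, 'k) mpoly" where "f = single (single x 1) 1"
  have "f \<in> weight_filtration (outside j) 1 \<longleftrightarrow> j \<noteq> i" for j
    using x by (simp add: f_def single_in_weight_filtration_iff outside_def)
  then have "g * f \<in> weight_filtration (outside j) 1 \<longleftrightarrow>
      g \<in> weight_filtration (outside j) 1 \<or> j \<noteq> i" for g j
    using ring_prime_ideal_weight_filtration[of "outside j", where ?'k = 'k]
      ring_ideal_weight_filtration[of "outside j" 1, where ?'b = 'k]
    by (metis mult.commute ring_ideal_mult ring_prime_idealD(3))
  then have "P = {g. g * f \<in> block_ideal}"
    unfolding i(2) block_power_def using i(1) by auto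
  then show "P \<in> Ass block_ideal"
    unfolding Ass_def i(2) using ring_prime_ideal_weight_filtration by blast
qed

lemma symbolic_power_block_ideal: "symbolic_power block_ideal m = block_power m"
  unfolding symbolic_power_def Ass_block_ideal block_power_def[of m]
    image_image by (intro INF_cong refl loc_contraction_block_ideal) simp

section \<open>Containment between symbolic and ordinary powers\<close>

lemma sum_outside: "(\<Sum>i<s. outside i x) = (if b x < s then s - 1 else s)"
proof -
  have "(\<Sum>i<s. outside i x) = (\<Sum>i\<in>{..<s} - {b x}. 1)"
    by (rule sum.mono_neutral_cong_right) (auto simp: outside_def)
  then show ?thesis by simp
qed

text \<open>Adding the outside degrees over all blocks gives \<open>m * s\<close>. A block variable
  contributes \<open>s - 1\<close> to the sum and any other variable \<open>s\<close>, which is at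
  most \<open>2 * (s - 1)\<close> for \<open>s \<ge> 2\<close>; hence the sum is at most
  \<open>s - 1\<close> times the generator weight. The same estimate of \<open>s\<close> yields
  \<open>r \<le> m\<close>.\<close>

lemma block_power_subset_ideal_pow:
  assumes "2 * r * (s - 1) \<le> m * s" "2 \<le> s"
  shows "block_power m \<subseteq> ideal_pow block_ideal r"
proof
  fix f assume f: "f \<in> block_power m"
  have "r * s \<le> r * (2 * (s - 1))" using assms(2) by (intro mult_left_mono) auto
  also have "\<dots> \<le> m * s" using assms(1) by (simp add: mult_ac)
  finally have "r \<le> m" using s_pos by simp
  show "f \<in> ideal_pow block_ideal r"
  proof (rule mem_ideal_if_monomials[OF ring_ideal_ideal_pow], rule single_in_ideal_pow_block_ideal)
    fix \<mu> assume \<mu>: "\<mu> \<in> keys f"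
    then have out: "m \<le> wdeg (outside i) \<mu>" if "i < s" for i
      using f that by (simp add: block_power_iff)
    then show "r \<le> wdeg (outside i) \<mu>" if "i < s" for i
      using that \<open>r \<le> m\<close> by (meson order_trans)
    have "m * s \<le> (\<Sum>i<s. wdeg (outside i) \<mu>)"
      using sum_mono[of "{..<s}" "\<lambda>_. m" "\<lambda>i. wdeg (outside i) \<mu>"] out by (simp add: mult.commute)
    also have "\<dots> \<le> wdeg (\<lambda>x. (s - 1) * generator_weight x) \<mu>"
      unfolding wdeg_weight_sum[symmetric] sum_outside
      by (rule wdeg_weight_mono) (use assms(2) in \<open>auto simp: generator_weight_def\<close>)
    also have "\<dots> = (s - 1) * wdeg generator_weight \<mu>" by (rule wdeg_weight_mult)
    finally have "2 * r * (s - 1) \<le> wdeg generator_weight \<mu> * (s - 1)"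
      using assms(1) by (simp only: mult.commute[of "s - 1"] order_trans)
    then show "2 * r \<le> wdeg generator_weight \<mu>" using assms(2) by simp
  qed
qed

text \<open>Only the degree within each block enters the conditions, so one arbitrarily chosen
  variable per block can carry the whole exponent.\<close>

definition transversal_monomial :: "nat \<Rightarrow> 'x \<Rightarrow>\<^sub>0 nat" where
  "transversal_monomial k = (\<Sum>i<s. single (SOME x. b x = i) k)"

lemma b_some: "i < s \<Longrightarrow> b (SOME x. b x = i) = i"
  using block_nonempty by (rule someI_ex)

lemma wdeg_transversal_monomial:
  "wdeg w (transversal_monomial k) = (\<Sum>i<s. w (SOME x. b x = i)) * k"
  by (simp add: transversal_monomial_def wdeg_sum wdeg_single sum_distrib_right)

lemma
  shows wdeg_outside_transversal: "i < s \<Longrightarrow> wdeg (outside i) (transversal_monomial k) = (s - 1) * k"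
    and wdeg_generator_transversal: "wdeg generator_weight (transversal_monomial k) = s * k"
    and monom_degree_transversal: "monom_degree (transversal_monomial k) = s * k"
proof -
  have "(\<Sum>j<s. outside i (SOME x. b x = j)) = (\<Sum>j\<in>{..<s} - {i}. 1)" if "i < s"
    using that by (subst sum.remove[of _ i]) (auto simp: outside_def b_some)
  then show "wdeg (outside i) (transversal_monomial k) = (s - 1) * k" if "i < s"
    using that by (simp add: wdeg_transversal_monomial)
  have "(\<Sum>j<s. generator_weight (SOME x. b x = j)) = (\<Sum>j<s. 1)"
    by (intro sum.cong refl) (simp add: generator_weight_def b_some)
  then show "wdeg generator_weight (transversal_monomial k) = s * k"
    by (simp add: wdeg_transversal_monomial)
qed (simp add: monom_degree_eq_wdeg wdeg_transversal_monomial)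

lemma block_power_not_subset_ideal_pow:
  assumes "m \<le> (s - 1) * k" "s * k < 2 * r"
  shows "\<not> block_power m \<subseteq> ideal_pow block_ideal r"
proof
  assume "block_power m \<subseteq> ideal_pow block_ideal r"
  moreover have "single (transversal_monomial k) 1 \<in> block_power m"
    using assms(1) by (simp add: single_in_block_power_iff wdeg_outside_transversal)
  ultimately have "single (transversal_monomial k) (1 :: 'k) \<in> weight_filtration generator_weight (2 * r)"
    using ideal_pow_block_ideal_subset by blast
  then show False
    using assms(2) by (simp add: single_in_weight_filtration_iff wdeg_generator_transversal)
qed

end

section \<open>Degrees of minimal generators\<close>

lemma mpoly_degree_homogeneous:
  assumes "f \<noteq> 0" "\<And>m. m \<in> keys f \<Longrightarrow> monom_degree m = d"
  shows "mpoly_degree f = d"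
proof -
  have "monom_degree ` keys f = (\<lambda>_. d) ` keys f" using assms(2) by (intro image_cong) auto
  also have "\<dots> = {d}" using keys_nonempty[OF assms(1)] by (simp add: image_constant_conv)
  finally show ?thesis by (simp add: mpoly_degree_def)
qed

text \<open>The predicate is left general for two uses: truncation by degree in the Nakayama
  argument, and selection of the monomials that survive restriction to a coordinate
  subspace.\<close>

definition mpoly_part :: "(('x \<Rightarrow>\<^sub>0 nat) \<Rightarrow> bool) \<Rightarrow> ('x, 'k::comm_ring_1) mpoly \<Rightarrow> ('x, 'k) mpoly" where
  "mpoly_part P f = (\<Sum>m\<in>{m\<in>keys f. P m}. single m (lookup f m))"

abbreviation low_part :: "nat \<Rightarrow> ('x, 'k::comm_ring_1) mpoly \<Rightarrow> ('x, 'k) mpoly" where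
  "low_part d \<equiv> mpoly_part (\<lambda>m. monom_degree m \<le> d)"

lemma lookup_mpoly_part: "lookup (mpoly_part P f) m = (lookup f m when P m)"
proof -
  have "lookup (mpoly_part P f) m = (\<Sum>m'\<in>{m\<in>keys f. P m}. if m = m' then lookup f m else 0)"
    unfolding mpoly_part_def lookup_sum by (intro sum.cong refl) (simp add: lookup_single when_def)
  then show ?thesis by (auto simp: when_def not_in_keys_iff_lookup_eq_zero)
qed

lemma mpoly_part_0: "mpoly_part P 0 = 0"
  by (simp add: mpoly_part_def)

lemma mpoly_part_add: "mpoly_part P (f + g) = mpoly_part P f + mpoly_part P g"
  by (rule poly_mapping_eqI) (simp add: lookup_mpoly_part lookup_add when_add_distrib)

lemma mpoly_part_sum: "mpoly_part P (sum g A) = (\<Sum>x\<in>A. mpoly_part P (g x))"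
  by (induction A rule: infinite_finite_induct) (simp_all add: mpoly_part_0 mpoly_part_add)

lemma mpoly_part_eq:
  assumes "\<And>m. m \<in> keys f \<Longrightarrow> P m"
  shows "mpoly_part P f = f"
proof -
  have "{m\<in>keys f. P m} = keys f" using assms by auto
  then show ?thesis by (simp add: mpoly_part_def poly_mapping_sum_monomials)
qed

lemma mpoly_part_eq_0:
  assumes "\<And>m. m \<in> keys f \<Longrightarrow> \<not> P m"
  shows "mpoly_part P f = 0"
proof -
  have "{m\<in>keys f. P m} = {}" using assms by auto
  then show ?thesis by (simp only: mpoly_part_def sum.empty)
qed

text \<open>Each product of \<open>g\<close> with a monomial is homogeneous of degree at least
  \<open>e\<close>, so truncation either keeps or kills it. For \<open>e > d\<close> all of them are
  killed, which is why \<open>g\<close> need lie in \<open>L\<close> only when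
  \<open>e \<le> d\<close>.\<close>

lemma low_part_mult_mem:
  fixes g :: "('x::finite, 'k::comm_ring_1) mpoly"
  assumes "ring_ideal L" "\<And>m. m \<in> keys g \<Longrightarrow> monom_degree m = e" "e \<le> d \<Longrightarrow> g \<in> L"
  shows "low_part d (c * g) \<in> L"
proof -
  have "low_part d (single a x * g) \<in> L" for a x
  proof -
    have deg: "monom_degree m = monom_degree a + e" if "m \<in> keys (single a x * g)" for m
    proof -
      from that obtain n where "n \<in> keys g" "m = a + n" by (rule keys_mult_single)
      then show ?thesis using assms(2)[of n] by (simp add: monom_degree_eq_wdeg wdeg_add)
    qed
    show ?thesis
    proof (cases "monom_degree a + e \<le> d")
      case True
      then have "low_part d (single a x * g) = single a x * g"
        by (intro mpoly_part_eq) (simp add: deg)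
      then show ?thesis using assms(1,3) True by (simp add: ring_ideal_mult)
    next
      case False
      then have "low_part d (single a x * g) = 0"
        by (intro mpoly_part_eq_0) (simp add: deg)
      then show ?thesis using ring_ideal_0[OF assms(1)] by simp
    qed
  qed
  then have "(\<Sum>a\<in>keys c. low_part d (single a (lookup c a) * g)) \<in> L"
    by (intro ring_ideal_sum assms(1))
  then show ?thesis
    unfolding mpoly_part_sum[symmetric] sum_distrib_right[symmetric] poly_mapping_sum_monomials .
qed

text \<open>A generator of degree above \<open>d\<close> does not contribute to the elements of degree at most \<open>d\<close>.\<close>

lemma min_hom_gens_degree_le:
  fixes G :: "('x::finite, 'k::comm_ring_1) mpoly set"
  assumes G: "min_hom_gens J G" and g: "g \<in> G"
    and J: "J = ideal_gen S" "\<And>f m. f \<in> S \<Longrightarrow> m \<in> keys f \<Longrightarrow> monom_degree m \<le> d"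
  shows "mpoly_degree g \<le> d"
proof (rule ccontr)
  assume contra: "\<not> ?thesis"
  let ?L = "ideal_gen (G - {g})"
  have hom: "\<And>h. h \<in> G \<Longrightarrow> homogeneous_poly h" and gen: "ideal_gen G = J" and
    min: "\<And>H. H \<subset> G \<Longrightarrow> ideal_gen H \<noteq> J"
    using G unfolding min_hom_gens_def by auto
  \<comment> \<open>The value of \<open>mpoly_degree\<close> at 0 is unspecified, but 0 is
    homogeneous of every degree, so a zero generator is refuted by the same argument.\<close>
  have "\<exists>e>d. \<forall>m\<in>keys g. monom_degree m = e"
  proof (cases "g = 0")
    case False
    obtain e where e: "\<forall>m\<in>keys g. monom_degree m = e"
      using hom[OF g] unfolding homogeneous_poly_def by blast
    from e have "mpoly_degree g = e" by (intro mpoly_degree_homogeneous[OF False]) blast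
    then show ?thesis using contra e by (intro exI[of _ e]) simp
  qed auto
  then obtain e where e: "d < e" "\<And>m. m \<in> keys g \<Longrightarrow> monom_degree m = e" by blast
  \<comment> \<open>Truncation kills every multiple of \<open>g\<close>, so what remains is
    generated by the other members of \<open>G\<close>.\<close>
  have low: "low_part d f \<in> ?L" if "f \<in> ideal_gen G" for f
    using that
  proof (induction rule: ideal_gen_induct)
    case zero
    then show ?case by (simp add: mpoly_part_0 ring_ideal_0[OF ring_ideal_ideal_gen])
  next
    case (add c h y)
    have "low_part d (c * h) \<in> ?L"
    proof (cases "h = g")
      case True
      then show ?thesis using e by (intro low_part_mult_mem[OF ring_ideal_ideal_gen]) auto
    next
      case False
      then have "h \<in> ?L" using add(1) by (intro ideal_gen_base) simp
      then show ?thesis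
        using hom[OF add(1)] low_part_mult_mem[OF ring_ideal_ideal_gen]
        unfolding homogeneous_poly_def by metis
    qed
    then show ?case
      using add(2) by (simp add: mpoly_part_add ring_ideal_add[OF ring_ideal_ideal_gen])
  qed
  have "f \<in> ?L" if "f \<in> S" for f
  proof -
    have "f \<in> ideal_gen G" using that J(1) gen by (simp add: ideal_gen_base)
    from low[OF this] show ?thesis using mpoly_part_eq[of f "\<lambda>m. monom_degree m \<le> d"] J(2)[OF that] by simp
  qed
  then have "J \<subseteq> ?L" unfolding J(1) by (intro ideal_gen_least ring_ideal_ideal_gen) auto
  moreover have "?L \<subseteq> J" unfolding gen[symmetric] by (rule ideal_gen_mono) auto
  ultimately show False using min[of "G - {g}"] g by blast
qed

text \<open>A ratio \<open>m / r\<close> counted asymptotically equals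
  \<open>(m * t') / (r * t')\<close>, and for some positive \<open>t'\<close> the latter is counted
  by the resurgence.\<close>

lemma asymptotic_resurgence_le_resurgence:
  "asymptotic_resurgence J \<le> resurgence J"
  unfolding asymptotic_resurgence_def
proof (rule Sup_least, clarify)
  fix m r assume mr: "0 < m" "0 < (r :: nat)"
    and ev: "\<forall>\<^sub>F t' in sequentially. \<not> symbolic_power J (m * t') \<subseteq> ideal_pow J (r * t')"
  have "\<forall>\<^sub>F t' in sequentially. 0 < t' \<and> \<not> symbolic_power J (m * t') \<subseteq> ideal_pow J (r * t')"
    using eventually_gt_at_top[of 0] ev by eventually_elim simp
  from eventually_happens'[OF sequentially_bot this]
  obtain t' where t': "0 < t'" "\<not> symbolic_power J (m * t') \<subseteq> ideal_pow J (r * t')" by blast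
  have "ereal (real (m * t') / real (r * t')) \<le> resurgence J"
    unfolding resurgence_def
    by (intro Sup_upper CollectI exI[of _ "m * t'"] exI[of _ "r * t'"]) (use mr t' in simp)
  then show "ereal (real m / real r) \<le> resurgence J" using t'(1) by simp
qed

context coordinate_blocks
begin

lemma generator_monomials_degree:
  assumes "\<kappa> \<in> generator_monomials" shows "monom_degree \<kappa> \<le> 2"
  using assms by (auto simp: generator_monomials_def monom_degree_eq_wdeg wdeg_add wdeg_single)

text \<open>All generators have generator weight 2 and every variable has positive weight, so no
  generator divides another. If \<open>\<kappa>\<close> is missing from \<open>H\<close>, then
  \<open>H\<close> generates only polynomials whose monomials are divisible by some other generator,
  and \<open>\<kappa>\<close> is not.\<close>

lemma min_hom_gens_generator_monomials:
  "min_hom_gens block_ideal ((\<lambda>\<kappa>. single \<kappa> 1) ` generator_monomials)"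
  unfolding min_hom_gens_def
proof (intro conjI ballI allI impI)
  show "homogeneous_poly g" if "g \<in> (\<lambda>\<kappa>. single \<kappa> (1 :: 'k)) ` generator_monomials" for g
    using that by (auto simp: homogeneous_poly_def)
  show "ideal_gen ((\<lambda>\<kappa>. single \<kappa> 1) ` generator_monomials) = block_ideal"
    by (rule block_ideal_eq_ideal_gen[symmetric])
  fix H :: "('x, 'k) mpoly set" assume H: "H \<subset> (\<lambda>\<kappa>. single \<kappa> 1) ` generator_monomials"
  then obtain \<kappa> where \<kappa>: "\<kappa> \<in> generator_monomials" "single \<kappa> 1 \<notin> H" by blast
  define L :: "('x, 'k) mpoly set" where
    "L = {f. \<forall>\<mu>\<in>keys f. \<exists>\<kappa>'\<in>generator_monomials. \<exists>\<nu>. \<kappa>' \<noteq> \<kappa> \<and> \<mu> = \<kappa>' + \<nu>}"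
  have "ring_ideal L"
    unfolding ring_ideal_iff
  proof (intro conjI ballI allI)
    show "f + g \<in> L" if "f \<in> L" "g \<in> L" for f g
      using that Poly_Mapping.keys_add[of f g] unfolding L_def by blast
    show "c * f \<in> L" if f: "f \<in> L" for c f
      unfolding L_def
    proof (intro CollectI ballI)
      fix \<mu> assume "\<mu> \<in> keys (c * f)"
      then obtain p q where "q \<in> keys f" "\<mu> = p + q" using keys_mult[of c f] by blast
      moreover from this(1) obtain \<kappa>' \<nu> where "\<kappa>' \<in> generator_monomials" "\<kappa>' \<noteq> \<kappa>" "q = \<kappa>' + \<nu>"
        using f unfolding L_def by blast
      ultimately show "\<exists>\<kappa>'\<in>generator_monomials. \<exists>\<nu>. \<kappa>' \<noteq> \<kappa> \<and> \<mu> = \<kappa>' + \<nu>"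
        by (metis add.left_commute)
    qed
  qed (simp add: L_def)
  moreover have "H \<subseteq> L"
  proof
    fix f assume "f \<in> H"
    then obtain \<kappa>' where "\<kappa>' \<in> generator_monomials" "f = single \<kappa>' 1" "\<kappa>' \<noteq> \<kappa>"
      using H \<kappa>(2) by blast
    then show "f \<in> L" unfolding L_def by (auto intro!: bexI[of _ \<kappa>'] exI[of _ 0])
  qed
  ultimately have sub: "ideal_gen H \<subseteq> L" by (rule ideal_gen_least[rotated])
  show "ideal_gen H \<noteq> block_ideal"
  proof
    assume "ideal_gen H = block_ideal"
    then have "single \<kappa> 1 \<in> L" using sub generator_monomial_in_block_ideal[OF \<kappa>(1)] by blast
    then obtain \<kappa>' \<nu> where *: "\<kappa>' \<in> generator_monomials" "\<kappa>' \<noteq> \<kappa>" "\<kappa> = \<kappa>' + \<nu>"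
      unfolding L_def by auto
    have "wdeg generator_weight \<kappa> = wdeg generator_weight \<kappa>' + wdeg generator_weight \<nu>"
      unfolding *(3) by (rule wdeg_add)
    then have "wdeg generator_weight \<nu> = 0"
      using *(1) \<kappa>(1) by (simp add: wdeg_generator_monomial)
    then have "keys \<nu> = {}"
      using wdeg_pos_iff[of generator_weight \<nu>] by (auto simp: generator_weight_def split: if_splits)
    then show False using *(2,3) by simp
  qed
qed

lemma omega_block_ideal:
  assumes "2 \<le> s"
  shows "omega block_ideal = 2"
  unfolding omega_def
proof (rule Greatest_equality)
  obtain x z where "b x = 0" "b z = 1"
    using block_nonempty[of 0] block_nonempty[of 1] assms by auto
  then have "single x 1 + single z 1 \<in> generator_monomials"
    using assms unfolding generator_monomials_def by force
  then show "\<exists>G. min_hom_gens block_ideal G \<and> (\<exists>g\<in>G. mpoly_degree g = 2)"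
    using min_hom_gens_generator_monomials
    by (intro exI[of _ "(\<lambda>\<kappa>. single \<kappa> 1) ` generator_monomials"] conjI
        bexI[of _ "single (single x 1 + single z 1) 1"])
       (auto simp: monom_degree_eq_wdeg wdeg_add wdeg_single)
next
  fix d assume "\<exists>G. min_hom_gens block_ideal G \<and> (\<exists>g\<in>G. mpoly_degree g = d)"
  then obtain G g where G: "min_hom_gens block_ideal G" "g \<in> G" and d: "d = mpoly_degree g" by blast
  show "d \<le> 2" unfolding d
    by (rule min_hom_gens_degree_le[OF G block_ideal_eq_ideal_gen])
       (auto dest: generator_monomials_degree)
qed

section \<open>Initial degrees and Waldschmidt constants\<close>

lemma sum_wdeg_outside: "(\<Sum>i<s. wdeg (outside i) \<mu>) = wdeg (\<lambda>x. if b x < s then s - 1 else s) \<mu>"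
  unfolding wdeg_weight_sum[symmetric] sum_outside ..

text \<open>The power \<open>m\<close> of a variable off all blocks satisfies every block condition
  at once and meets the lower bound imposed by a single block.\<close>

lemma alpha_block_power_cone:
  assumes "s \<le> b y" shows "alpha (block_power m) = m"
proof (rule antisym)
  have y: "single (single y m) 1 \<in> block_power m"
    using assms by (auto simp: single_in_block_power_iff)
  have "alpha (block_power m) \<le> mpoly_degree (single (single y m) (1 :: 'k))"
    using y by (rule alpha_le) (metis lookup_single_eq lookup_zero one_neq_zero)
  then show "alpha (block_power m) \<le> m"
    by (simp add: monom_degree_eq_wdeg wdeg_single)
  show "m \<le> alpha (block_power m)"
  proof (rule alpha_ge[OF y])
    fix f \<mu> assume "f \<in> block_power m" "\<mu> \<in> keys f"
    then have "m \<le> wdeg (outside 0) \<mu>" using s_pos by (simp add: block_power_iff)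
    also have "\<dots> \<le> monom_degree \<mu>"
      unfolding monom_degree_eq_wdeg by (rule wdeg_weight_mono) (simp add: outside_def)
    finally show "m \<le> monom_degree \<mu>" .
  qed (metis lookup_single_eq lookup_zero one_neq_zero)
qed

lemma alpha_block_power_le:
  assumes "m \<le> (s - 1) * k" shows "alpha (block_power m) \<le> s * k"
proof -
  have "single (transversal_monomial k) 1 \<in> block_power m"
    using assms by (simp add: single_in_block_power_iff wdeg_outside_transversal)
  then have "alpha (block_power m) \<le> mpoly_degree (single (transversal_monomial k) (1 :: 'k))"
    by (rule alpha_le) (metis lookup_single_eq lookup_zero one_neq_zero)
  then show ?thesis by (simp add: monom_degree_transversal)
qed

lemma alpha_block_power_ge:
  assumes "\<And>x. b x < s" "2 \<le> s" shows "s * m \<le> (s - 1) * alpha (block_power m)"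
proof -
  have "1 * m \<le> (s - 1) * m" by (rule mult_le_mono1) (use assms(2) in simp)
  then have ne: "single (transversal_monomial m) (1 :: 'k) \<in> block_power m"
    by (simp add: single_in_block_power_iff wdeg_outside_transversal)
  \<comment> \<open>This quotient is \<open>s * m / (s - 1)\<close> rounded up, since the degree
    bound has to be a natural number.\<close>
  have "(s * m + (s - 2)) div (s - 1) \<le> alpha (block_power m)"
  proof (rule alpha_ge[OF ne])
    fix f \<mu> assume "f \<in> block_power m" "\<mu> \<in> keys f"
    then have "s * m \<le> (\<Sum>i<s. wdeg (outside i) \<mu>)"
      using sum_mono[of "{..<s}" "\<lambda>_. m" "\<lambda>i. wdeg (outside i) \<mu>"] by (simp add: block_power_iff)
    also have "\<dots> = (s - 1) * monom_degree \<mu>"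
      unfolding sum_wdeg_outside monom_degree_eq_wdeg wdeg_weight_mult[symmetric]
      using assms(1) by simp
    finally have "s * m + (s - 2) < (s - 1) * Suc (monom_degree \<mu>)" using assms(2) by simp
    then show "(s * m + (s - 2)) div (s - 1) \<le> monom_degree \<mu>"
      by (metis less_mult_imp_div_less less_Suc_eq_le mult.commute)
  qed (metis lookup_single_eq lookup_zero one_neq_zero)
  then have "(s - 1) * ((s * m + (s - 2)) div (s - 1)) \<le> (s - 1) * alpha (block_power m)"
    by (rule mult_le_mono2)
  moreover have "s * m \<le> (s - 1) * ((s * m + (s - 2)) div (s - 1))"
  proof -
    have "(s * m + (s - 2)) mod (s - 1) < s - 1" using assms(2) by simp
    then show ?thesis
      using mult_div_mod_eq[of "s - 1" "s * m + (s - 2)"] assms(2) by linarith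
  qed
  ultimately show ?thesis by linarith
qed

lemma alpha_block_ideal_no_cone:
  assumes "\<And>x. b x < s" "2 \<le> s" shows "alpha block_ideal = 2"
proof (rule antisym)
  obtain x z where xz: "b x = 0" "b z = 1"
    using block_nonempty[of 0] block_nonempty[of 1] assms(2) by auto
  then have "single x 1 + single z 1 \<in> generator_monomials"
    using assms unfolding generator_monomials_def by force
  then have "alpha block_ideal \<le> mpoly_degree (single (single x 1 + single z 1) (1 :: 'k))"
    using generator_monomial_in_block_ideal
    by (intro alpha_le) (metis lookup_single_eq lookup_zero one_neq_zero)+
  then show "alpha block_ideal \<le> 2"
    by (simp add: monom_degree_eq_wdeg wdeg_add wdeg_single)
  show "2 \<le> alpha block_ideal"
  proof (rule ccontr)
    assume "\<not> ?thesis"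
    then have "(s - 1) * alpha block_ideal \<le> (s - 1) * 1" by (intro mult_le_mono2) simp
    moreover have "s * 1 \<le> (s - 1) * alpha block_ideal" by (rule alpha_block_power_ge[OF assms])
    ultimately show False using assms(2) by linarith
  qed
qed

lemma waldschmidt_block_ideal_cone:
  assumes "s \<le> b y" shows "waldschmidt block_ideal = 1"
  unfolding waldschmidt_def symbolic_power_block_ideal alpha_block_power_cone[OF assms]
proof (rule limI)
  \<comment> \<open>At \<open>m = 0\<close> the quotient is 0 by the convention on division, so the
    sequence is only eventually constant.\<close>
  have "\<forall>\<^sub>F m in sequentially. real m / real m = 1"
    using eventually_gt_at_top[of 0] by eventually_elim simp
  then show "(\<lambda>m. real m / real m) \<longlonglongrightarrow> 1" by (rule tendsto_eventually)
qed

lemma waldschmidt_block_ideal_no_cone: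
  assumes "\<And>x. b x < s" "2 \<le> s" shows "waldschmidt block_ideal = real s / (real s - 1)"
  unfolding waldschmidt_def symbolic_power_block_ideal
proof (rule limI, rule tendsto_sandwich)
  let ?u = "\<lambda>m. real s / (real s - 1) + real s / real m"
  have s: "real (s - 1) = real s - 1" "real s - 1 > 0" using assms(2) by auto
  show "\<forall>\<^sub>F m in sequentially. real s / (real s - 1) \<le> real (alpha (block_power m)) / real m"
    using eventually_gt_at_top[of 0]
  proof eventually_elim
    case (elim m)
    have "real (s * m) \<le> real ((s - 1) * alpha (block_power m))"
      using alpha_block_power_ge[OF assms] by (simp only: of_nat_le_iff)
    then show ?case using elim s by (simp add: field_simps)
  qed
  show "\<forall>\<^sub>F m in sequentially. real (alpha (block_power m)) / real m \<le> ?u m"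
    using eventually_gt_at_top[of 0]
  proof eventually_elim
    case (elim m)
    \<comment> \<open>Rounding \<open>m / (s - 1)\<close> up in this way costs at most one unit of
      \<open>k\<close>, hence at most \<open>s\<close> in degree, which is the error term
      \<open>s / m\<close> in the upper bound.\<close>
    define k where "k = m div (s - 1) + 1"
    have "m < (s - 1) * k"
      unfolding k_def using assms(2) dividend_less_times_div[of "s - 1" m] by simp
    then have "alpha (block_power m) \<le> s * k" by (intro alpha_block_power_le) simp
    then have "real (alpha (block_power m)) \<le> real (s * k)" by (rule of_nat_mono)
    also have "\<dots> \<le> real s * (real m / real (s - 1) + 1)"
      unfolding k_def of_nat_mult of_nat_add
      by (intro mult_left_mono add_mono) (simp_all add: of_nat_div_le_of_nat)
    finally have "real (alpha (block_power m)) / real m \<le> real s * (real m / real (s - 1) + 1) / real m"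
      by (rule divide_right_mono) simp
    also have "\<dots> = ?u m"
      unfolding s(1) using elim by (simp add: add_divide_distrib distrib_left)
    finally show ?case .
  qed
  show "?u \<longlonglongrightarrow> real s / (real s - 1)"
    using tendsto_add[OF tendsto_const lim_const_over_n] by fastforce
qed simp

section \<open>Resurgences of the block ideal\<close>

lemma eventually_not_subset:
  assumes "2 \<le> s" "m * s < 2 * r * (s - 1)"
  shows "\<forall>\<^sub>F t in sequentially. \<not> block_power (m * t) \<subseteq> ideal_pow block_ideal (r * t)"
  \<comment> \<open>A strict inequality of integers gains at least \<open>t\<close> when scaled by
    \<open>t\<close>. The transversal exponent \<open>q + 1\<close> is
    \<open>m * t / (s - 1)\<close> rounded up, with an error of at most \<open>s * (s - 1)\<close>
    in the scaled inequality, so larger \<open>t\<close> absorb it.\<close>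
  using eventually_gt_at_top[of "s * (s - 1)"]
proof eventually_elim
  case (elim t)
  define q where "q = (m * t) div (s - 1)"
  have q: "(s - 1) * q \<le> m * t" "m * t < (s - 1) * q + (s - 1)"
    unfolding q_def using assms(1) dividend_less_times_div[of "s - 1" "m * t"] by simp_all
  show ?case
  proof (rule block_power_not_subset_ideal_pow)
    show "m * t \<le> (s - 1) * (q + 1)" using q(2) by simp
    have "(s - 1) * (s * (q + 1)) = s * ((s - 1) * q) + s * (s - 1)" by (simp add: algebra_simps)
    also have "\<dots> < s * (m * t) + t" using q(1) elim by (intro add_le_less_mono mult_le_mono2)
    also have "\<dots> = (m * s + 1) * t" by (simp add: algebra_simps)
    also have "\<dots> \<le> (2 * r * (s - 1)) * t" using assms(2) by (intro mult_le_mono1) simp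
    finally have "(s - 1) * (s * (q + 1)) < (s - 1) * (2 * (r * t))" by (simp add: mult_ac)
    then show "s * (q + 1) < 2 * (r * t)" by simp
  qed
qed

lemma resurgence_block_ideal_le:
  assumes "2 \<le> s"
  shows "resurgence block_ideal \<le> ereal (2 * (real s - 1) / real s)"
  unfolding resurgence_def symbolic_power_block_ideal
proof (rule Sup_least)
  fix q assume "q \<in> {ereal (real m / real r) |m r.
    0 < m \<and> 0 < r \<and> \<not> block_power m \<subseteq> ideal_pow block_ideal r}"
  then obtain m r where q: "q = ereal (real m / real r)" and r: "0 < r"
    and "\<not> block_power m \<subseteq> ideal_pow block_ideal r" by blast
  then have "m * s < 2 * r * (s - 1)"
    using block_power_subset_ideal_pow[of r m] assms by linarith
  then have "real (m * s) < real (2 * r * (s - 1))" by (simp only: of_nat_less_iff)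
  then show "q \<le> ereal (2 * (real s - 1) / real s)"
    using r assms by (simp add: q field_simps of_nat_diff)
qed

lemma asymptotic_resurgence_block_ideal_ge:
  assumes "2 \<le> s"
  shows "ereal (2 * (real s - 1) / real s) \<le> asymptotic_resurgence block_ideal"
proof (rule LIMSEQ_le_const2)
  let ?c = "2 * (real s - 1) / real s"
  have "(\<lambda>r. ?c - 1 / real s * inverse (real (Suc r))) \<longlonglongrightarrow> ?c - 1 / real s * 0"
    by (intro tendsto_intros LIMSEQ_inverse_real_of_nat)
  then show "(\<lambda>r. ereal (?c - 1 / real s * inverse (real (Suc r)))) \<longlonglongrightarrow> ereal ?c"
    by simp
  have "ereal (?c - 1 / real s * inverse (real (Suc r))) \<le> asymptotic_resurgence block_ideal" for r
  proof -
    \<comment> \<open>The critical ratio is not itself attained. With denominator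
      \<open>s * Suc r\<close> this is the largest numerator strictly below it, leaving a gap of
      \<open>1 / (s * Suc r)\<close> that tends to 0.\<close>
    define m where "m = 2 * (s - 1) * Suc r - 1"
    have pos: "1 \<le> (s - 1) * Suc r" using assms by simp
    then have m: "m + 1 = 2 * (s - 1) * Suc r" "0 < m" unfolding m_def by simp_all
    then have "m * s < 2 * (s * Suc r) * (s - 1)"
      using assms by (metis add_gr_0 less_add_one mult.assoc mult.commute mult_less_mono1 zero_less_numeral order_less_le_trans)
    then have "\<forall>\<^sub>F t in sequentially. \<not> block_power (m * t) \<subseteq> ideal_pow block_ideal (s * Suc r * t)"
      by (rule eventually_not_subset[OF assms])
    then have "ereal (real m / real (s * Suc r)) \<le> asymptotic_resurgence block_ideal"
      unfolding asymptotic_resurgence_def symbolic_power_block_ideal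
      by (intro Sup_upper CollectI exI[of _ m] exI[of _ "s * Suc r"]) (use m(2) s_pos in simp)
    moreover have "real m / real (s * Suc r) = ?c - 1 / real s * inverse (real (Suc r))"
    proof -
      define M where "M = real (Suc r)"
      have M: "M > 0" by (simp add: M_def)
      have "real m + 1 = 2 * (real s - 1) * M"
        using arg_cong[OF m(1), of real] assms by (simp add: M_def of_nat_diff algebra_simps)
      then have m_eq: "real m = 2 * (real s - 1) * M - 1" by simp
      show ?thesis
        unfolding of_nat_mult M_def[symmetric] m_eq using s_pos M by (simp add: field_simps)
    qed
    ultimately show ?thesis by simp
  qed
  then show "\<exists>N. \<forall>r\<ge>N. ereal (?c - 1 / real s * inverse (real (Suc r))) \<le> asymptotic_resurgence block_ideal"
    by blast
qed

end

section \<open>Linear changes of coordinates\<close>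

definition linear_form :: "'k::comm_ring_1 ^ 'n \<Rightarrow> ('n::finite, 'k) mpoly" where
  "linear_form c = (\<Sum>j\<in>UNIV. single (single j 1) (c $ j))"

text \<open>The pullback of \<open>f\<close> along \<open>v \<mapsto> A *v v\<close>: each variable
  is replaced by the linear form of the corresponding row of \<open>A\<close>.\<close>

definition linear_subst :: "'k::comm_ring_1 ^ 'n ^ 'n \<Rightarrow> ('n::finite, 'k) mpoly \<Rightarrow> ('n, 'k) mpoly" where
  "linear_subst A f =
     (\<Sum>m\<in>keys f. single 0 (lookup f m) * (\<Prod>x\<in>UNIV. linear_form (A $ x) ^ lookup m x))"

lemma mpoly_eval_linear_form: "mpoly_eval (linear_form c) (($) v) = (\<Sum>j\<in>UNIV. c $ j * v $ j)"
  by (simp add: linear_form_def mpoly_eval_sum mpoly_eval_single)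

lemma mpoly_eval_linear_subst:
  "mpoly_eval (linear_subst A f) (($) v) = mpoly_eval f (($) (A *v v))"
proof -
  have "mpoly_eval (linear_form (A $ x)) (($) v) = (A *v v) $ x" for x
    by (simp add: mpoly_eval_linear_form matrix_vector_mult_def)
  then have "mpoly_eval (linear_subst A f) (($) v) =
      (\<Sum>m\<in>keys f. lookup f m * (\<Prod>x\<in>UNIV. ((A *v v) $ x) ^ lookup m x))"
    by (simp add: linear_subst_def mpoly_eval_sum mpoly_eval_mult mpoly_eval_single
        mpoly_eval_prod mpoly_eval_power)
  also have "\<dots> = mpoly_eval f (($) (A *v v))"
    unfolding mpoly_eval_def
    by (intro sum.cong refl arg_cong2[of _ _ _ _ "(*)"] prod_power_keys_superset[symmetric]) auto
  finally show ?thesis .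
qed

lemma mpoly_eqI_eval_vec:
  fixes f g :: "('n::finite, 'k::alg_closed_field) mpoly"
  assumes "\<And>v :: 'k ^ 'n. mpoly_eval f (($) v) = mpoly_eval g (($) v)"
  shows "f = g"
proof (rule mpoly_eqI_eval)
  fix a :: "'n \<Rightarrow> 'k"
  have "a = ($) (\<chi> i. a i)" by (simp add: fun_eq_iff)
  then show "mpoly_eval f a = mpoly_eval g a" using assms by metis
qed

lemma linear_subst_inverse:
  fixes f :: "('n::finite, 'k::alg_closed_field) mpoly"
  assumes "B ** A = mat 1"
  shows "linear_subst A (linear_subst B f) = f"
  by (rule mpoly_eqI_eval_vec)
     (simp add: mpoly_eval_linear_subst matrix_vector_mul_assoc assms)

text \<open>Additivity, multiplicativity and invertibility are all checked on values, where the
  substitution is composition with the matrix.\<close>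

lemma ring_automorphism_linear_subst:
  fixes A :: "'k::alg_closed_field ^ 'n::finite ^ 'n"
  assumes "invertible A"
  shows "ring_automorphism (linear_subst A)"
proof
  obtain B where "A ** B = mat 1" "B ** A = mat 1"
    using assms unfolding invertible_def by blast
  then show "bij (linear_subst A)"
    by (intro o_bij[of "linear_subst B"]) (simp_all add: fun_eq_iff linear_subst_inverse)
qed (rule mpoly_eqI_eval_vec, simp add: mpoly_eval_linear_subst mpoly_eval_add mpoly_eval_mult)+

text \<open>Unlike \<open>homogeneous_poly\<close>, this names the degree, so that degrees add up in
  products; 0 has every degree.\<close>

definition has_degree :: "nat \<Rightarrow> ('x, 'k::comm_ring_1) mpoly \<Rightarrow> bool" where
  "has_degree d f \<longleftrightarrow> (\<forall>m\<in>keys f. monom_degree m = d)"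

lemma has_degree_sum: "(\<And>i. i \<in> A \<Longrightarrow> has_degree d (g i)) \<Longrightarrow> has_degree d (sum g A)"
  using keys_sum[of g A] unfolding has_degree_def by blast

lemma has_degree_single: "has_degree (monom_degree m) (single m c)"
  by (simp add: has_degree_def)

lemma has_degree_mult:
  fixes f g :: "('x::finite, 'k::comm_ring_1) mpoly"
  assumes "has_degree d f" "has_degree e g" shows "has_degree (d + e) (f * g)"
  unfolding has_degree_def
proof
  fix m assume "m \<in> keys (f * g)"
  then obtain a b where "a \<in> keys f" "b \<in> keys g" "m = a + b" using keys_mult[of f g] by blast
  then show "monom_degree m = d + e"
    using assms by (simp add: has_degree_def monom_degree_eq_wdeg wdeg_add)
qed

lemma has_degree_0_const: "has_degree 0 (single 0 c)"
  using has_degree_single[of 0 c] by (simp add: monom_degree_def)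

lemma has_degree_power:
  fixes f :: "('x::finite, 'k::comm_ring_1) mpoly"
  assumes "has_degree d f" shows "has_degree (n * d) (f ^ n)"
proof (induction n)
  case 0
  then show ?case using has_degree_0_const[of 1] by simp
qed (simp add: has_degree_mult assms)

lemma has_degree_prod:
  fixes g :: "'i \<Rightarrow> ('x::finite, 'k::comm_ring_1) mpoly"
  assumes "finite A" "\<And>i. i \<in> A \<Longrightarrow> has_degree (d i) (g i)"
  shows "has_degree (\<Sum>i\<in>A. d i) (prod g A)"
  using assms
proof (induction A rule: finite_induct)
  case empty
  then show ?case using has_degree_0_const[of 1] by simp
qed (simp add: has_degree_mult)

lemma has_degree_linear_form: "has_degree 1 (linear_form c)"
  unfolding linear_form_def
proof (rule has_degree_sum)
  fix j
  show "has_degree 1 (single (single j 1) (c $ j))"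
    using has_degree_single[of "single j 1" "c $ j"] by (simp add: monom_degree_eq_wdeg wdeg_single)
qed

lemma keys_linear_subst:
  assumes "m' \<in> keys (linear_subst A f)"
  obtains m where "m \<in> keys f" "monom_degree m' = monom_degree m"
proof -
  have "has_degree (0 + (\<Sum>x\<in>UNIV. lookup m x * 1))
      (single 0 (lookup f m) * (\<Prod>x\<in>UNIV. linear_form (A $ x) ^ lookup m x))" for m
    by (intro has_degree_mult has_degree_0_const has_degree_prod has_degree_power has_degree_linear_form) simp
  then have "has_degree (monom_degree m)
      (single 0 (lookup f m) * (\<Prod>x\<in>UNIV. linear_form (A $ x) ^ lookup m x))" for m
    by (simp add: monom_degree_eq_wdeg wdeg_def)
  moreover obtain m where "m \<in> keys f"
      "m' \<in> keys (single 0 (lookup f m) * (\<Prod>x\<in>UNIV. linear_form (A $ x) ^ lookup m x))"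
    using assms keys_sum[of "\<lambda>m. single 0 (lookup f m) * (\<Prod>x\<in>UNIV. linear_form (A $ x) ^ lookup m x)" "keys f"]
    unfolding linear_subst_def by blast
  ultimately show thesis using that unfolding has_degree_def by blast
qed

section \<open>Invariance under degree-preserving automorphisms\<close>

locale graded_automorphism = ring_automorphism \<phi>
  for \<phi> :: "('x, 'k::comm_ring_1) mpoly \<Rightarrow> ('x, 'k) mpoly" +
  assumes degree: "mpoly_degree (\<phi> f) = mpoly_degree f"
    and homogeneous: "homogeneous_poly (\<phi> f) \<longleftrightarrow> homogeneous_poly f"
begin

lemma eq_0_iff: "\<phi> f = 0 \<longleftrightarrow> f = 0"
  using zero bij by (metis bij_is_inj injD)

lemma alpha_image: "alpha (\<phi> ` J) = alpha J"
  unfolding alpha_def by (simp add: eq_0_iff degree)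

lemma waldschmidt_image: "waldschmidt (\<phi> ` J) = waldschmidt J"
  unfolding waldschmidt_def symbolic_power_image alpha_image ..

lemma min_hom_gens_image: "min_hom_gens (\<phi> ` J) (\<phi> ` G) \<longleftrightarrow> min_hom_gens J G"
proof -
  have inj: "inj \<phi>" using bij by (rule bij_is_inj)
  have "(\<forall>H. H \<subset> \<phi> ` G \<longrightarrow> ideal_gen H \<noteq> \<phi> ` J) \<longleftrightarrow>
      (\<forall>H. \<phi> ` H \<subset> \<phi> ` G \<longrightarrow> ideal_gen (\<phi> ` H) \<noteq> \<phi> ` J)"
    by (metis psubset_imp_subset subset_image_iff)
  also have "\<dots> \<longleftrightarrow> (\<forall>H. H \<subset> G \<longrightarrow> ideal_gen H \<noteq> J)"
    by (simp add: ideal_gen_image inj_image_eq_iff[OF inj] psubset_eq inj_image_subset_iff[OF inj])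
  finally show ?thesis
    unfolding min_hom_gens_def
    by (simp add: ideal_gen_image inj_image_eq_iff[OF inj] homogeneous)
qed

lemma omega_image: "omega (\<phi> ` J) = omega J"
proof -
  have "(\<exists>G. min_hom_gens (\<phi> ` J) G \<and> (\<exists>g\<in>G. mpoly_degree g = d)) \<longleftrightarrow>
      (\<exists>G. min_hom_gens (\<phi> ` J) (\<phi> ` G) \<and> (\<exists>g\<in>\<phi> ` G. mpoly_degree g = d))" for d
    using bij by (metis bij_is_surj surj_image_vimage_eq)
  then show ?thesis
    unfolding omega_def min_hom_gens_image by (simp add: degree)
qed

end

text \<open>Substituting linear forms cannot raise the degree, and neither can the inverse
  substitution. The zero polynomial is treated apart because its degree is the unspecified maximum
  of the empty set.\<close>

lemma mpoly_degree_linear_subst: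
  fixes A :: "'k::alg_closed_field ^ 'n::finite ^ 'n"
  assumes "invertible A"
  shows "mpoly_degree (linear_subst A f) = mpoly_degree f"
proof (cases "f = 0")
  case True
  then show ?thesis by (simp add: linear_subst_def)
next
  case False
  obtain B where AB: "A ** B = mat 1" "B ** A = mat 1"
    using assms unfolding invertible_def by blast
  have inv: "linear_subst B (linear_subst A f) = f" using AB by (simp add: linear_subst_inverse)
  have le: "mpoly_degree (linear_subst C g) \<le> mpoly_degree g" if "linear_subst C g \<noteq> 0"
    for C :: "'k ^ 'n ^ 'n" and g
    unfolding mpoly_degree_def[of "linear_subst C g"]
  proof (rule Max.boundedI)
    fix d assume "d \<in> monom_degree ` keys (linear_subst C g)"
    then obtain m' where "m' \<in> keys (linear_subst C g)" "d = monom_degree m'" by blast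
    then show "d \<le> mpoly_degree g"
      by (metis keys_linear_subst monom_degree_le_mpoly_degree)
  qed (use that in simp_all)
  have "linear_subst A f \<noteq> 0"
  proof
    assume "linear_subst A f = 0"
    then have "linear_subst B 0 = f" using inv by simp
    then show False using False by (simp add: linear_subst_def)
  qed
  then show ?thesis using le[of A f] le[of B "linear_subst A f"] inv False by simp
qed

lemma graded_automorphism_linear_subst:
  fixes A :: "'k::alg_closed_field ^ 'n::finite ^ 'n"
  assumes "invertible A"
  shows "graded_automorphism (linear_subst A)"
proof (intro graded_automorphism.intro ring_automorphism_linear_subst[OF assms]
    graded_automorphism_axioms.intro mpoly_degree_linear_subst[OF assms])
  have hom: "homogeneous_poly (linear_subst C g)" if "homogeneous_poly g" for C :: "'k ^ 'n ^ 'n" and g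
    using that unfolding homogeneous_poly_def by (metis keys_linear_subst)
  obtain B where "A ** B = mat 1" using assms unfolding invertible_def by blast
  then have "linear_subst B (linear_subst A f) = f" for f by (rule linear_subst_inverse)
  then show "homogeneous_poly (linear_subst A f) \<longleftrightarrow> homogeneous_poly f" for f
    using hom[of f A] hom[of "linear_subst A f" B] by auto
qed

section \<open>Vanishing ideals of unions of subspaces\<close>

lemma vanishing_ideal_linear_subvarieties:
  fixes V :: "'i \<Rightarrow> ('k::field ^ 'n) set"
  assumes "\<And>i. i \<in> S \<Longrightarrow> V i \<in> grassmannian t" "1 \<le> t"
  shows "vanishing_ideal (\<Union>i\<in>S. linear_subvariety (V i)) =
    ideal_gen {f. homogeneous_poly f \<and> (\<forall>i\<in>S. \<forall>v\<in>V i. mpoly_eval f (($) v) = 0)}"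
proof -
  have "\<Union> (linear_subvariety (V i)) = V i" if "i \<in> S" for i
  proof (intro equalityI subsetI)
    fix v assume v: "v \<in> V i"
    have V: "vec.subspace (V i)" "vec.dim (V i) = t" using assms(1)[OF that] by (auto simp: grassmannian_def)
    have "\<exists>u. u \<in> V i \<and> u \<noteq> 0 \<and> v \<in> vec.span {u}"
    proof (cases "v = 0")
      case True
      \<comment> \<open>The zero vector lies on a line inside \<open>V i\<close> only because
        \<open>V i\<close> has positive dimension.\<close>
      have "\<not> V i \<subseteq> {0}"
      proof
        assume "V i \<subseteq> {0}"
        then have "vec.dim (V i) \<le> vec.dim ({0} :: ('k ^ 'n) set)" by (rule vec.dim_subset)
        then show False using V(2) assms(2) by simp
      qed
      then show ?thesis using True vec.span_zero by blast
    next
      case False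
      then show ?thesis using v vec.span_base[of v "{v}"] by blast
    qed
    then obtain u where u: "u \<in> V i" "u \<noteq> 0" "v \<in> vec.span {u}" by blast
    have "vec.span {u} \<in> linear_subvariety (V i)"
      using u V(1) vec.span_minimal[of "{u}" "V i"]
      by (simp add: linear_subvariety_def proj_space_def vec.dim_span_eq_card_independent
          vec.dependent_single)
    then show "v \<in> \<Union> (linear_subvariety (V i))" using u(3) by blast
  qed (auto simp: linear_subvariety_def)
  then have "(\<forall>l\<in>\<Union>i\<in>S. linear_subvariety (V i). \<forall>v\<in>l. mpoly_eval f (($) v) = 0) \<longleftrightarrow>
      (\<forall>i\<in>S. \<forall>v\<in>V i. mpoly_eval f (($) v) = 0)" for f by blast
  then show ?thesis unfolding vanishing_ideal_def by simp
qed

context coordinate_blocks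
begin

definition coordinate_subspace :: "nat \<Rightarrow> ('k ^ 'x) set" where
  "coordinate_subspace i = {v. \<forall>x. b x \<noteq> i \<longrightarrow> v $ x = 0}"

text \<open>Restriction to the \<open>i\<close>-th subspace kills exactly the monomials of positive
  \<open>outside i\<close> weight. If the restriction vanishes, then over an infinite field no
  monomial of weight 0 can be left.\<close>

lemma vanishing_on_coordinate_subspaces:
  assumes "infinite (UNIV :: 'k set)"
  shows "ideal_gen {f. homogeneous_poly f \<and> (\<forall>i<s. \<forall>v\<in>coordinate_subspace i. mpoly_eval f (($) v) = 0)}
    = block_ideal" (is "ideal_gen ?G = _")
proof
  show "ideal_gen ?G \<subseteq> block_ideal"
  proof (intro ideal_gen_least ring_ideal_block_power subsetI)
    fix f assume f: "f \<in> ?G"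
    have "mpoly_part (\<lambda>\<mu>. wdeg (outside i) \<mu> = 0) f = 0" if i: "i < s" for i
    proof (rule mpoly_eq_0_if_eval_eq_0[OF assms])
      fix a :: "'x \<Rightarrow> 'k"
      \<comment> \<open>The projection of an arbitrary point to the subspace: evaluating
        \<open>f\<close> at \<open>v\<close> is evaluating its weight 0 part at \<open>a\<close>
        itself, so that part vanishes at every point.\<close>
      define v :: "'k ^ 'x" where "v = (\<chi> x. if b x = i then a x else 0)"
      have v: "(\<Prod>x\<in>keys \<mu>. v $ x ^ lookup \<mu> x) =
        (if wdeg (outside i) \<mu> = 0 then \<Prod>x\<in>keys \<mu>. a x ^ lookup \<mu> x else 0)" for \<mu>
      proof (cases "wdeg (outside i) \<mu> = 0")
        case True
        then have "b x = i" if "x \<in> keys \<mu>" for x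
          using that wdeg_pos_iff[of "outside i" \<mu>] by (auto simp: outside_def split: if_splits)
        then show ?thesis using True by (simp add: v_def)
      next
        case False
        then obtain x where x: "x \<in> keys \<mu>" "b x \<noteq> i"
          using wdeg_pos_iff[of "outside i" \<mu>] by (auto simp: outside_def split: if_splits)
        then have "v $ x ^ lookup \<mu> x = 0" by (simp add: v_def in_keys_iff)
        then show ?thesis using False x(1) by (auto intro!: prod_zero)
      qed
      have "v \<in> coordinate_subspace i" by (simp add: v_def coordinate_subspace_def)
      then have "0 = mpoly_eval f (($) v)" using f i by simp
      also have "\<dots> = (\<Sum>\<mu>\<in>keys f. if wdeg (outside i) \<mu> = 0
          then lookup f \<mu> * (\<Prod>x\<in>keys \<mu>. a x ^ lookup \<mu> x) else 0)"
        unfolding mpoly_eval_def v by (intro sum.cong refl) simp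
      also have "\<dots> = mpoly_eval (mpoly_part (\<lambda>\<mu>. wdeg (outside i) \<mu> = 0) f) a"
        unfolding mpoly_part_def mpoly_eval_sum mpoly_eval_single
        by (rule sum.inter_filter[symmetric]) simp
      finally show "mpoly_eval (mpoly_part (\<lambda>\<mu>. wdeg (outside i) \<mu> = 0) f) a = 0" by simp
    qed
    then have "(lookup f \<mu> when wdeg (outside i) \<mu> = 0) = 0" if "i < s" for i \<mu>
      using that lookup_mpoly_part[of "\<lambda>\<mu>. wdeg (outside i) \<mu> = 0" f \<mu>] by simp
    then have "0 < wdeg (outside i) \<mu>" if "i < s" "\<mu> \<in> keys f" for i \<mu>
      using that by (metis gr0I in_keys_iff when_simps(1))
    then show "f \<in> block_ideal" by (simp add: block_power_iff Suc_le_eq)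
  qed
  have "single \<kappa> 1 \<in> ?G" if \<kappa>: "\<kappa> \<in> generator_monomials" for \<kappa>
  proof (intro CollectI conjI allI impI ballI)
    show "homogeneous_poly (single \<kappa> (1 :: 'k))" by (auto simp: homogeneous_poly_def)
    fix i v assume i: "i < s" and v: "v \<in> coordinate_subspace i"
    have "0 < wdeg (outside i) \<kappa>"
      using generator_monomial_in_block_ideal[OF \<kappa>] i by (auto simp: single_in_block_power_iff Suc_le_eq)
    then obtain x where x: "x \<in> keys \<kappa>" "b x \<noteq> i"
      unfolding wdeg_pos_iff by (auto simp: outside_def split: if_splits)
    then have "v $ x ^ lookup \<kappa> x = 0" using v by (simp add: coordinate_subspace_def in_keys_iff)
    then show "mpoly_eval (single \<kappa> 1) (($) v) = 0"
      using x(1) by (auto simp: mpoly_eval_single intro!: prod_zero)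
  qed
  then show "block_ideal \<subseteq> ideal_gen ?G"
    unfolding block_ideal_eq_ideal_gen by (intro ideal_gen_mono) blast
qed

end

section \<open>General position\<close>

lemma mpoly_vars_mult: "mpoly_vars (f * g) \<subseteq> mpoly_vars f \<union> mpoly_vars g"
proof
  fix x assume "x \<in> mpoly_vars (f * g)"
  then obtain m where "m \<in> keys (f * g)" "x \<in> keys m" by (auto simp: mpoly_vars_def)
  then obtain p q where "p \<in> keys f" "q \<in> keys g" "x \<in> keys (p + q)" using keys_mult[of f g] by blast
  then show "x \<in> mpoly_vars f \<union> mpoly_vars g"
    using Poly_Mapping.keys_add[of p q] by (auto simp: mpoly_vars_def)
qed

lemma mpoly_vars_sum: "(\<And>i. i \<in> A \<Longrightarrow> mpoly_vars (g i) \<subseteq> S) \<Longrightarrow> mpoly_vars (sum g A) \<subseteq> S"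
  using keys_sum[of g A] unfolding mpoly_vars_def by blast

lemma mpoly_vars_const: "mpoly_vars (single 0 c) = {}"
  by (simp add: mpoly_vars_def)

lemma mpoly_vars_prod: "(\<And>i. i \<in> A \<Longrightarrow> mpoly_vars (g i) \<subseteq> S) \<Longrightarrow> mpoly_vars (prod g A) \<subseteq> S"
proof (induction A rule: infinite_finite_induct)
  case (insert x A)
  then show ?case using mpoly_vars_mult[of "g x" "prod g A"] by fastforce
qed (simp_all add: mpoly_vars_def)

lemma mpoly_vars_det:
  fixes M :: "('x, 'k::comm_ring_1) mpoly ^ 'n ^ 'n"
  assumes "\<And>r c. mpoly_vars (M $ r $ c) \<subseteq> S"
  shows "mpoly_vars (det M) \<subseteq> S"
  unfolding det_def
proof (rule mpoly_vars_sum)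
  fix p :: "'n \<Rightarrow> 'n"
  have "mpoly_vars (of_int (sign p) :: ('x, 'k) mpoly) = {}"
    by (simp add: mpoly_vars_const flip: single_of_int)
  moreover have "mpoly_vars (\<Prod>i\<in>UNIV. M $ i $ p i) \<subseteq> S"
    using assms by (rule mpoly_vars_prod)
  ultimately show "mpoly_vars (of_int (sign p) * (\<Prod>i\<in>UNIV. M $ i $ p i)) \<subseteq> S"
    using mpoly_vars_mult[of "of_int (sign p)" "\<Prod>i\<in>UNIV. M $ i $ p i"] by blast
qed

lemma mpoly_eval_det:
  fixes M :: "('x, 'k::comm_ring_1) mpoly ^ 'n ^ 'n"
  shows "mpoly_eval (det M) a = det (\<chi> r c. mpoly_eval (M $ r $ c) a)"
  by (simp add: det_def mpoly_eval_sum mpoly_eval_mult mpoly_eval_prod mpoly_eval_of_int)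

lemma matrix_vector_mult_axis: "(A :: 'k::field ^ 'n ^ 'm) *v axis x 1 = column x A"
  by (simp add: matrix_vector_mult_def column_def axis_def vec_eq_iff if_distrib cong: if_cong)

section \<open>Frames that extend to a basis\<close>

locale coordinate_frames =
  fixes s t :: nat and e :: "nat \<times> nat \<Rightarrow> 'n::finite" and ty :: "'k::field itself"
  assumes s_pos: "0 < s" and t_pos: "0 < t" and inj_e: "inj_on e ({..<s} \<times> {..<t})"
begin

text \<open>The block of a variable is read off from its index pair. The value \<open>s\<close>
  marks the variables not reached by \<open>e\<close>, which vanish on every coordinate
  subspace.\<close>

definition block :: "'n \<Rightarrow> nat" where
  "block x = (if x \<in> e ` ({..<s} \<times> {..<t}) then fst (inv_into ({..<s} \<times> {..<t}) e x) else s)"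

lemma block_e: "i < s \<Longrightarrow> j < t \<Longrightarrow> block (e (i, j)) = i"
  using inj_e by (auto simp: block_def)

lemma block_eq_iff: "i < s \<Longrightarrow> block x = i \<longleftrightarrow> (\<exists>j<t. x = e (i, j))"
proof
  assume i: "i < s" and x: "block x = i"
  then have "x \<in> e ` ({..<s} \<times> {..<t})" by (simp add: block_def split: if_splits)
  then obtain i' j where j: "i' < s" "j < t" "x = e (i', j)" by auto
  then have "i' = i" using x block_e by simp
  then show "\<exists>j<t. x = e (i, j)" using j by auto
qed (auto simp: block_e)

sublocale coordinate_blocks s block ty
  using s_pos t_pos block_e by unfold_locales auto

lemma coordinate_subspace_eq_span:
  assumes "i < s"
  shows "coordinate_subspace i = vec.span ((\<lambda>j. axis (e (i, j)) 1) ` {..<t})"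
proof
  show "coordinate_subspace i \<subseteq> vec.span ((\<lambda>j. axis (e (i, j)) 1) ` {..<t})"
  proof
    fix v assume v: "v \<in> coordinate_subspace i"
    have "v = (\<Sum>x\<in>UNIV. v $ x *s axis x 1)" by (rule basis_expansion[symmetric])
    also have "\<dots> \<in> vec.span ((\<lambda>j. axis (e (i, j)) 1) ` {..<t})"
    proof (rule vec.span_sum)
      fix x
      show "v $ x *s axis x 1 \<in> vec.span ((\<lambda>j. axis (e (i, j)) 1) ` {..<t})"
      proof (cases "block x = i")
        case True
        then show ?thesis
          using block_eq_iff[OF assms] by (intro vec.span_scale vec.span_base) auto
      next
        case False
        then have "v $ x *s axis x 1 = 0" using v by (simp add: coordinate_subspace_def)
        then show ?thesis by (simp add: vec.span_zero)
      qed
    qed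
    finally show "v \<in> vec.span ((\<lambda>j. axis (e (i, j)) 1) ` {..<t})" .
  qed
  have "vec.subspace (coordinate_subspace i)"
    by (rule vec.subspaceI) (auto simp: coordinate_subspace_def)
  moreover have "(\<lambda>j. axis (e (i, j)) 1) ` {..<t} \<subseteq> coordinate_subspace i"
    using block_e[OF assms] by (auto simp: coordinate_subspace_def axis_def)
  ultimately show "vec.span ((\<lambda>j. axis (e (i, j)) 1) ` {..<t}) \<subseteq> coordinate_subspace i"
    by (intro vec.span_minimal)
qed

lemma frame_axes:
  assumes "i < s" shows "frame t (\<lambda>j. axis (e (i, j)) (1 :: 'k))"
  unfolding frame_def
proof
  show "inj_on (\<lambda>j. axis (e (i, j)) (1 :: 'k)) {..<t}"
    using inj_e assms by (auto simp: inj_on_def axis_eq_axis)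
  show "vec.independent ((\<lambda>j. axis (e (i, j)) (1 :: 'k)) ` {..<t})"
    by (rule vec.independent_mono[OF independent_cart_basis]) (auto simp: cart_basis_def)
qed

lemma span_frame_in_grassmannian: "frame t w \<Longrightarrow> vec.span (w ` {..<t}) \<in> grassmannian t"
  by (simp add: frame_def grassmannian_def vec.dim_eq_card_independent card_image)

definition frame_matrix :: "(nat \<Rightarrow> nat \<Rightarrow> 'k ^ 'n) \<Rightarrow> 'k ^ 'n ^ 'n \<Rightarrow> 'k ^ 'n ^ 'n" where
  "frame_matrix w C = (\<chi> r c. if block c < s
     then w (block c) (snd (inv_into ({..<s} \<times> {..<t}) e c)) $ r else C $ r $ c)"

text \<open>Only the frame entries become indeterminates, while the completing columns remain
  constants. Each \<open>C\<close> thus yields one polynomial in the frame coordinates alone, as the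
  definition of open sets demands.\<close>

definition generic_frame_matrix :: "'k ^ 'n ^ 'n \<Rightarrow> (nat \<times> nat \<times> 'n, 'k) mpoly ^ 'n ^ 'n" where
  "generic_frame_matrix C = (\<chi> r c. if block c < s
     then single (single (block c, snd (inv_into ({..<s} \<times> {..<t}) e c), r) 1) 1
     else single 0 (C $ r $ c))"

lemma mpoly_eval_det_generic_frame_matrix:
  "mpoly_eval (det (generic_frame_matrix C)) (\<lambda>(i, j, c). w i j $ c) = det (frame_matrix w C)"
  unfolding mpoly_eval_det
  by (rule arg_cong[of _ _ det])
     (simp add: generic_frame_matrix_def frame_matrix_def vec_eq_iff mpoly_eval_single)

lemma snd_inv_e: "block c < s \<Longrightarrow> snd (inv_into ({..<s} \<times> {..<t}) e c) < t"
proof -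
  assume "block c < s"
  then have "c \<in> e ` ({..<s} \<times> {..<t})" by (auto simp: block_def split: if_splits)
  then have "inv_into ({..<s} \<times> {..<t}) e c \<in> {..<s} \<times> {..<t}" by (rule inv_into_into)
  then show ?thesis by auto
qed

lemma mpoly_vars_det_generic_frame_matrix:
  "mpoly_vars (det (generic_frame_matrix C)) \<subseteq> {..<s} \<times> {..<t} \<times> UNIV"
proof (rule mpoly_vars_det)
  show "mpoly_vars (generic_frame_matrix C $ r $ c) \<subseteq> {..<s} \<times> {..<t} \<times> UNIV" for r c
    by (auto simp: generic_frame_matrix_def mpoly_vars_const snd_inv_e)
       (auto simp: mpoly_vars_def snd_inv_e)
qed

lemma column_frame_matrix:
  shows "i < s \<Longrightarrow> j < t \<Longrightarrow> column (e (i, j)) (frame_matrix w C) = w i j"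
    and "s \<le> block c \<Longrightarrow> column c (frame_matrix w C) = column c C"
  using inj_e by (simp_all add: column_def frame_matrix_def vec_eq_iff block_e)

lemma image_coordinate_subspace:
  assumes "i < s"
  shows "(*v) A ` coordinate_subspace i = vec.span ((\<lambda>j. column (e (i, j)) A) ` {..<t})"
  unfolding coordinate_subspace_eq_span[OF assms] vec.span_image[symmetric] image_image
  by (simp add: matrix_vector_mult_axis)

lemma span_columns_iff: "invertible (A :: 'k ^ 'n ^ 'n) \<longleftrightarrow> vec.span (columns A) = UNIV"
  by (simp add: invertible_right_inverse matrix_right_invertible_span_columns)

text \<open>
  The frames in general position are those that extend to a basis. Their locus is the union, over
  all possible completions, of the loci where the determinant does not vanish.
\<close>

lemma frames_transversal_iff:
  "(\<exists>A :: 'k ^ 'n ^ 'n. invertible A \<and> (\<forall>i<s. vec.span (w i ` {..<t}) = (*v) A ` coordinate_subspace i)) \<longleftrightarrow>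
    (\<exists>C. det (frame_matrix w C) \<noteq> 0)"
proof
  assume "\<exists>A :: 'k ^ 'n ^ 'n. invertible A \<and> (\<forall>i<s. vec.span (w i ` {..<t}) = (*v) A ` coordinate_subspace i)"
  then obtain A :: "'k ^ 'n ^ 'n" where A: "invertible A"
    "\<And>i. i < s \<Longrightarrow> vec.span (w i ` {..<t}) = (*v) A ` coordinate_subspace i" by blast
  let ?M = "frame_matrix w A"
  \<comment> \<open>The columns of \<open>A\<close> itself serve as completion: inside a block they
    lie in the span of the frame, elsewhere the two matrices agree, so the columns of
    \<open>?M\<close> span the whole space.\<close>
  have "column c A \<in> vec.span (columns ?M)" for c
  proof (cases "block c < s")
    case True
    then obtain j where j: "j < t" "c = e (block c, j)" using block_eq_iff by blast
    have "column c A \<in> vec.span (w (block c) ` {..<t})"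
      unfolding A(2)[OF True] image_coordinate_subspace[OF True]
      using j by (intro vec.span_base) (metis imageI lessThan_iff)
    also have "w (block c) ` {..<t} \<subseteq> columns ?M"
    proof
      fix u assume "u \<in> w (block c) ` {..<t}"
      then obtain j where "j < t" "u = column (e (block c, j)) ?M"
        using column_frame_matrix(1)[OF True] by auto
      then show "u \<in> columns ?M" by (auto simp: columns_def)
    qed
    then have "vec.span (w (block c) ` {..<t}) \<subseteq> vec.span (columns ?M)" by (rule vec.span_mono)
    finally show ?thesis .
  next
    case False
    then have "column c A = column c ?M" by (simp add: column_frame_matrix(2))
    then show ?thesis by (auto simp: columns_def intro: vec.span_base)
  qed
  then have "vec.span (columns A) \<subseteq> vec.span (columns ?M)"
    by (intro vec.span_minimal) (auto simp: columns_def)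
  then have "invertible ?M" using A(1) unfolding span_columns_iff by blast
  then show "\<exists>C. det (frame_matrix w C) \<noteq> 0" unfolding invertible_det_nz by blast
next
  assume "\<exists>C. det (frame_matrix w C) \<noteq> 0"
  then obtain C where "invertible (frame_matrix w C)" unfolding invertible_det_nz by blast
  moreover have "vec.span (w i ` {..<t}) = (*v) (frame_matrix w C) ` coordinate_subspace i" if "i < s" for i
    using that by (simp add: image_coordinate_subspace column_frame_matrix(1) cong: image_cong_simp)
  ultimately show "\<exists>A :: 'k ^ 'n ^ 'n. invertible A \<and>
      (\<forall>i<s. vec.span (w i ` {..<t}) = (*v) A ` coordinate_subspace i)" by blast
qed

text \<open>The orbit of the tuple of coordinate subspaces under invertible matrices; it serves as
  the open set of general tuples.\<close>

definition transversal_tuples :: "(nat \<Rightarrow> ('k ^ 'n) set) set" where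
  "transversal_tuples = {V \<in> \<Pi>\<^sub>E i\<in>{..<s}. grassmannian t.
     \<exists>A :: 'k ^ 'n ^ 'n. invertible A \<and> (\<forall>i<s. V i = (*v) A ` coordinate_subspace i)}"

lemma zariski_open_transversal_tuples: "zariski_open_grassmannians s t transversal_tuples"
  unfolding zariski_open_grassmannians_def
proof (intro conjI exI allI impI)
  show "transversal_tuples \<subseteq> (\<Pi>\<^sub>E i\<in>{..<s}. grassmannian t)"
    by (auto simp: transversal_tuples_def)
  show "\<forall>f\<in>range (\<lambda>C. det (generic_frame_matrix C)). mpoly_vars f \<subseteq> {..<s} \<times> {..<t} \<times> UNIV"
    using mpoly_vars_det_generic_frame_matrix by blast
  fix w :: "nat \<Rightarrow> nat \<Rightarrow> 'k ^ 'n" assume "\<forall>i<s. frame t (w i)"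
  then have "(\<lambda>i\<in>{..<s}. vec.span (w i ` {..<t})) \<in> (\<Pi>\<^sub>E i\<in>{..<s}. grassmannian t)"
    using span_frame_in_grassmannian by auto
  then have "(\<lambda>i\<in>{..<s}. vec.span (w i ` {..<t})) \<in> transversal_tuples \<longleftrightarrow>
      (\<exists>C. det (frame_matrix w C) \<noteq> 0)"
    unfolding frames_transversal_iff[symmetric] transversal_tuples_def by simp
  then show "(\<lambda>i\<in>{..<s}. vec.span (w i ` {..<t})) \<in> transversal_tuples \<longleftrightarrow>
      (\<exists>f\<in>range (\<lambda>C. det (generic_frame_matrix C)). mpoly_eval f (\<lambda>(i, j, c). w i j $ c) \<noteq> 0)"
    by (simp add: mpoly_eval_det_generic_frame_matrix)
qed

lemma transversal_tuples_nonempty: "transversal_tuples \<noteq> {}"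
proof -
  have "coordinate_subspace i \<in> grassmannian t" if "i < s" for i
    unfolding coordinate_subspace_eq_span[OF that]
    by (rule span_frame_in_grassmannian[OF frame_axes[OF that]])
  then have "(\<lambda>i\<in>{..<s}. coordinate_subspace i) \<in> transversal_tuples"
    by (auto simp: transversal_tuples_def intro!: exI[of _ "mat 1"] simp: invertible_def
        intro: exI[of _ "mat 1"])
  then show ?thesis by blast
qed

end

section \<open>From coordinate subspaces to general subspaces\<close>

lemma (in coordinate_blocks) block_ideal_trivial:
  assumes "\<And>x. b x < s" "s = 1"
  shows "block_ideal = {0}"
proof (intro equalityI subsetI)
  fix f assume "f \<in> block_ideal"
  then have "wdeg (outside 0) \<mu> > 0" if "\<mu> \<in> keys f" for \<mu>
    using that s_pos by (force simp: block_power_iff)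
  moreover have "wdeg (outside 0) \<mu> = 0" for \<mu>
    using assms by (simp add: wdeg_def outside_def)
  ultimately have "keys f = {}" by fastforce
  then show "f \<in> {0}" by simp
qed (simp add: ring_ideal_0[OF ring_ideal_block_power])

text \<open>A polynomial vanishes on the image of \<open>W i\<close> under \<open>A\<close> iff its
  pullback vanishes on \<open>W i\<close>, and pullback preserves homogeneity in both directions, so
  the two generating sets correspond.\<close>

lemma linear_subst_image_vanishing_ideal:
  fixes A :: "'k::alg_closed_field ^ 'n::finite ^ 'n"
  assumes "invertible A"
  shows "linear_subst A ` ideal_gen {f. homogeneous_poly f \<and> (\<forall>i\<in>S. \<forall>v\<in>(*v) A ` W i. mpoly_eval f (($) v) = 0)}
    = ideal_gen {f. homogeneous_poly f \<and> (\<forall>i\<in>S. \<forall>v\<in>W i. mpoly_eval f (($) v) = 0)}"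
proof -
  interpret graded_automorphism "linear_subst A"
    by (rule graded_automorphism_linear_subst[OF assms])
  have "linear_subst A ` {f. homogeneous_poly f \<and> (\<forall>i\<in>S. \<forall>v\<in>(*v) A ` W i. mpoly_eval f (($) v) = 0)}
    = {f. homogeneous_poly f \<and> (\<forall>i\<in>S. \<forall>v\<in>W i. mpoly_eval f (($) v) = 0)}" (is "_ ` ?F = ?G")
  proof -
    have iff: "linear_subst A f \<in> ?G \<longleftrightarrow> f \<in> ?F" for f
      by (simp add: homogeneous mpoly_eval_linear_subst)
    show ?thesis
    proof (intro equalityI subsetI)
      fix g assume "g \<in> ?G"
      moreover obtain f where "g = linear_subst A f" using bij by (metis bij_pointE)
      ultimately show "g \<in> linear_subst A ` ?F" using iff[of f] by blast
    next
      fix g assume "g \<in> linear_subst A ` ?F"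
      then show "g \<in> ?G" using iff by blast
    qed
  qed
  then show ?thesis by (simp flip: ideal_gen_image)
qed

theorem theorem7p2:
  fixes s t n :: nat
  assumes "s \<ge> 1" and "t \<ge> 1"
    and "CARD('n::finite) = n + 1"
    and "s * t \<le> n + 1"
  shows "for_general_subspaces s t (\<lambda>V :: nat \<Rightarrow> ('k::alg_closed_field ^ 'n) set.
    let X = (\<Union>i<s. linear_subvariety (V i));
        I = vanishing_ideal X
    in I \<noteq> {0} \<longrightarrow>
      waldschmidt I = (if s * t < n + 1 then 1 else real (n + 1) / (real (n + 1) - real t)) \<and>
      (s \<ge> 2 \<longrightarrow>
         resurgence I = ereal (2 * (real s - 1) / real s) \<and>
         asymptotic_resurgence I = ereal (2 * (real s - 1) / real s)) \<and>
      (n + 1 = s * t \<longrightarrow>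
         ereal (real (alpha I) / waldschmidt I) = asymptotic_resurgence I \<and>
         asymptotic_resurgence I = resurgence I \<and>
         resurgence I = ereal (real (omega I) / waldschmidt I)) \<and>
      (s * t \<le> n \<and> s \<ge> 3 \<longrightarrow>
         ereal (real (alpha I) / waldschmidt I) < asymptotic_resurgence I \<and>
         asymptotic_resurgence I = resurgence I \<and>
         resurgence I < ereal (real (omega I) / waldschmidt I)))"
proof -
  let ?P = "{..<s} \<times> {..<t}"
  have "card ?P \<le> card (UNIV :: 'n set)" using assms(3,4) by simp
  then obtain e :: "nat \<times> nat \<Rightarrow> 'n" where e: "inj_on e ?P"
    using card_le_inj[of ?P "UNIV :: 'n set"] by auto
  interpret coordinate_frames s t e "TYPE('k)"
    using assms(1,2) e by unfold_locales auto
  have card_e: "card (e ` ?P) = s * t" using e by (simp add: card_image)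
  have cone: "\<exists>y. s \<le> block y" if "s * t < n + 1"
  proof -
    have "e ` ?P \<noteq> UNIV" using card_e assms(3) that by auto
    then show ?thesis by (auto simp: block_def)
  qed
  have no_cone: "block x < s" if "s * t = n + 1" for x
  proof -
    have "e ` ?P = UNIV" using card_e assms(3) that by (intro card_subset_eq) auto
    then obtain i j where "x = e (i, j)" "i < s" "j < t" by (force simp: set_eq_iff)
    then show ?thesis by (simp add: block_e)
  qed
  show ?thesis
    unfolding for_general_subspaces_def
  proof (intro exI[of _ transversal_tuples] conjI ballI)
    show "zariski_open_grassmannians s t transversal_tuples" by (rule zariski_open_transversal_tuples)
    show "transversal_tuples \<noteq> {}" by (rule transversal_tuples_nonempty)
    fix V assume "V \<in> transversal_tuples"
    then have V: "\<And>i. i < s \<Longrightarrow> V i \<in> grassmannian t"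
      and "\<exists>A :: 'k ^ 'n ^ 'n. invertible A \<and> (\<forall>i<s. V i = (*v) A ` coordinate_subspace i)"
      unfolding transversal_tuples_def by (auto intro: PiE_mem)
    then obtain A :: "'k ^ 'n ^ 'n" where
      A: "invertible A" "\<And>i. i < s \<Longrightarrow> V i = (*v) A ` coordinate_subspace i" by blast
    define I where "I = vanishing_ideal (\<Union>i<s. linear_subvariety (V i))"
    interpret \<phi>: graded_automorphism "linear_subst A"
      by (rule graded_automorphism_linear_subst[OF A(1)])
    have "I = ideal_gen {f. homogeneous_poly f \<and>
        (\<forall>i\<in>{..<s}. \<forall>v\<in>(*v) A ` coordinate_subspace i. mpoly_eval f (($) v) = 0)}"
      unfolding I_def using V A(2) assms(2)
      by (subst vanishing_ideal_linear_subvarieties[of _ _ t]) auto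
    then have I: "linear_subst A ` I = block_ideal"
      using linear_subst_image_vanishing_ideal[OF A(1), of "{..<s}" coordinate_subspace]
        vanishing_on_coordinate_subspaces[OF infinite_alg_closed_field]
      by (simp add: Ball_def)
    note inv = \<phi>.waldschmidt_image[of I] \<phi>.alpha_image[of I] \<phi>.omega_image[of I]
      resurgence_automorphism_image[OF \<phi>.ring_automorphism_axioms, of I]
      asymptotic_resurgence_automorphism_image[OF \<phi>.ring_automorphism_axioms, of I]
    have res: "resurgence I = ereal (2 * (real s - 1) / real s)"
      "asymptotic_resurgence I = ereal (2 * (real s - 1) / real s)" if "2 \<le> s"
      using resurgence_block_ideal_le[OF that] asymptotic_resurgence_block_ideal_ge[OF that]
        asymptotic_resurgence_le_resurgence[of block_ideal]
      unfolding inv(4,5)[symmetric] I by (auto intro: antisym order_trans)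
    have omega: "omega I = 2" if "2 \<le> s"
      using omega_block_ideal[OF that] inv(3) unfolding I by simp
    have a1: "alpha I = 1" "waldschmidt I = 1" if lt: "s * t < n + 1"
    proof -
      obtain y where y: "s \<le> block y" using cone[OF lt] by blast
      show "alpha I = 1" "waldschmidt I = 1"
        using alpha_block_power_cone[OF y, of 1] waldschmidt_block_ideal_cone[OF y] inv(1,2)
        unfolding I by simp_all
    qed
    have a2: "alpha I = 2" "waldschmidt I = real s / (real s - 1)" if "s * t = n + 1" "2 \<le> s"
      using alpha_block_ideal_no_cone[OF no_cone[OF that(1)] that(2)]
        waldschmidt_block_ideal_no_cone[OF no_cone[OF that(1)] that(2)] inv(1,2)
      unfolding I by simp_all
    \<comment> \<open>For \<open>s = 1\<close> and \<open>t = n + 1\<close> the only subspace is the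
      whole space and its ideal is zero; this is the case that \<open>I \<noteq> {0}\<close>
      excludes.\<close>
    have s2: "2 \<le> s" if "s * t = n + 1" "I \<noteq> {0}"
    proof (rule ccontr)
      assume "\<not> 2 \<le> s"
      then have "s = 1" using assms(1) by simp
      then have "linear_subst A ` I = {0}"
        unfolding I using block_ideal_trivial no_cone[OF that(1)] by blast
      then have "I \<subseteq> {0}" using \<phi>.eq_0_iff by blast
      moreover have "0 \<in> I" unfolding I_def vanishing_ideal_def
        by (rule ring_ideal_0[OF ring_ideal_ideal_gen])
      ultimately show False using that(2) by blast
    qed
    \<comment> \<open>Substituting \<open>n + 1 = s * t\<close> makes \<open>t\<close> a common
      factor of numerator and denominator.\<close>
    have quot: "real (n + 1) / (real (n + 1) - real t) = real s / (real s - 1)" if "s * t = n + 1"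
    proof -
      have "real (n + 1) / (real (n + 1) - real t) = (real s * real t) / ((real s - 1) * real t)"
        unfolding that[symmetric] by (simp add: algebra_simps)
      then show ?thesis using assms(2) by simp
    qed
    have "waldschmidt I = (if s * t < n + 1 then 1 else real (n + 1) / (real (n + 1) - real t))"
      if "I \<noteq> {0}"
      using a1(2) a2(2) s2[OF _ that] quot assms(4) by (cases "s * t < n + 1") auto
    \<comment> \<open>When the blocks exhaust the variables, all generators are quadrics:
      \<open>alpha\<close> and \<open>omega\<close> are both 2, and dividing 2 by
      \<open>s / (s - 1)\<close> gives the resurgence.\<close>
    moreover have "ereal (real (alpha I) / waldschmidt I) = asymptotic_resurgence I \<and>
         asymptotic_resurgence I = resurgence I \<and>
         resurgence I = ereal (real (omega I) / waldschmidt I)" if "I \<noteq> {0}" "n + 1 = s * t"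
    proof -
      have s: "2 \<le> s" using s2 that by simp
      then show ?thesis
        unfolding a2(1)[OF that(2)[symmetric] s] a2(2)[OF that(2)[symmetric] s] res[OF s] omega[OF s]
        by (simp add: field_simps)
    qed
    \<comment> \<open>Here the two quotients are 1 and 2, and \<open>1 < 2 * (s - 1) / s\<close>
      amounts to \<open>s > 2\<close>.\<close>
    moreover have "ereal (real (alpha I) / waldschmidt I) < asymptotic_resurgence I \<and>
         asymptotic_resurgence I = resurgence I \<and>
         resurgence I < ereal (real (omega I) / waldschmidt I)" if "s * t \<le> n" "3 \<le> s"
    proof -
      have "2 \<le> s" "s * t < n + 1" using that by auto
      then show ?thesis
        unfolding a1[OF \<open>s * t < n + 1\<close>] res[OF \<open>2 \<le> s\<close>] omega[OF \<open>2 \<le> s\<close>]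
        using that(2) by (simp add: field_simps)
    qed
    ultimately show "let X = (\<Union>i<s. linear_subvariety (V i)); I = vanishing_ideal X
      in I \<noteq> {0} \<longrightarrow>
        waldschmidt I = (if s * t < n + 1 then 1 else real (n + 1) / (real (n + 1) - real t)) \<and>
        (s \<ge> 2 \<longrightarrow>
           resurgence I = ereal (2 * (real s - 1) / real s) \<and>
           asymptotic_resurgence I = ereal (2 * (real s - 1) / real s)) \<and>
        (n + 1 = s * t \<longrightarrow>
           ereal (real (alpha I) / waldschmidt I) = asymptotic_resurgence I \<and>
           asymptotic_resurgence I = resurgence I \<and>
           resurgence I = ereal (real (omega I) / waldschmidt I)) \<and>
        (s * t \<le> n \<and> s \<ge> 3 \<longrightarrow>
           ereal (real (alpha I) / waldschmidt I) < asymptotic_resurgence I \<and>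
           asymptotic_resurgence I = resurgence I \<and>
           resurgence I < ereal (real (omega I) / waldschmidt I))"
      unfolding Let_def I_def[symmetric] using res by blast
  qed
qed

end
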